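(* Let $K$ be a field of characteristic $0$, let $n\ge 2$, let $X=\{x_1,\dots,x_n\}$, and let $p\ge 1$. Suppose that, as a $\mathrm{GL}(n)$-module, $$F_n(\mathfrak N_p)=K\langle X\rangle/I_{p+1}\cong\bigoplus_{\lambda}m_\lambda V_\lambda ,$$ where $\lambda=(\lambda_1,\lambda_2,\dots,\lambda_n)$ runs over non-negative integer partitions and $m_\lambda$ are multiplicities. Then every $\lambda$ with $m_\lambda\ne 0$ satisfies $\lambda_2\le p-1$.
   Context: $V$ is the $K$-vector space with basis $X$, and $K\langle X\rangle$ is the free (unital) associative algebra on $X$, identified with the tensor algebra $T(V)$. Left-normed commutators: $[u_1,u_2]=u_1u_2-u_2u_1$ and $[u_1,\dots,u_i]=[[u_1,\dots,u_{i-1}],u_i]$ for $i\ge 3$. For $m\ge 2$, $I_m$ is the two-sided ideal of $K\langle X\rangle$ generated by all commutators $[u_1,\dots,u_m]$ with $u_1,\dots,u_m\in K\langle X\rangle$. The group $\mathrm{GL}(n)=\mathrm{GL}(V,K)$ acts on $V$ and, diagonally by algebra automorphisms, on $K\langle X\rangle$; $I_{p+1}$ is a $\mathrm{GL}(n)$-submodule, so $F_n(\mathfrak N_p)$ is a $\mathrm{GL}(n)$-module. For a partition $\lambda=(\lambda_1\ge\dots\ge\lambda_n\ge0)$ with integer parts, $V_\lambda$ is the irreducible polynomial $\mathrm{GL}(n)$-module corresponding to $\lambda$ (highest weight $\lambda$). *)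

theory Defs
  imports
    "Jordan_Normal_Form.VS_Connect"
    "HOL-Algebra.QuotRing"
    "HOL-Library.Poly_Mapping"
begin

section \<open>The free associative algebra\<close>

text \<open>
  Words over \<open>'x\<close> form the free monoid, written additively so that the convolution product of
  \<^type>\<open>poly_mapping\<close> makes finitely supported functions on words into the monoid algebra,
  i.e. the free unital associative algebra.
\<close>

datatype 'x free_word = Word (letters: "'x list")

instantiation free_word :: (type) monoid_add
begin

definition "0 = Word []"
definition "u + v = Word (letters u @ letters v)"

instance
  by standard (simp_all add: zero_free_word_def plus_free_word_def)

end

type_synonym 'k free_alg = "nat free_word \<Rightarrow>\<^sub>0 'k"

definition scalar :: "'k \<Rightarrow> 'k::field free_alg"
  where "scalar c = Poly_Mapping.single 0 c"

definition gen :: "nat \<Rightarrow> 'k::field free_alg"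
  where "gen i = Poly_Mapping.single (Word [i]) 1"

text \<open>
  The generators \<open>x\<^sub>1, \<dots>, x\<^sub>n\<close> are \<open>gen 0, \<dots>, gen (n - 1)\<close>, in line with the numbering of matrix
  entries.
\<close>

definition free_algebra :: "nat \<Rightarrow> 'k::field free_alg ring"
  where "free_algebra n =
    \<lparr>carrier = {f. \<forall>w \<in> Poly_Mapping.keys f. set (letters w) \<subseteq> {..<n}},
     mult = (*), one = 1, zero = 0, add = (+)\<rparr>"

text \<open>The left-normed commutator of a nonempty list.\<close>

definition left_normed_comm :: "'a::ring list \<Rightarrow> 'a"
  where "left_normed_comm us = foldl (\<lambda>u v. u * v - v * u) (hd us) (tl us)"

definition comm_ideal :: "nat \<Rightarrow> nat \<Rightarrow> 'k::field free_alg set"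
  where "comm_ideal n m = Idl\<^bsub>free_algebra n\<^esub>
    {left_normed_comm us | us. length us = m \<and> set us \<subseteq> carrier (free_algebra n)}"


section \<open>\<open>GL(n)\<close>-modules\<close>

definition GL :: "nat \<Rightarrow> 'k::field mat set"
  where "GL n = {g \<in> carrier_mat n n. invertible_mat g}"

record ('k, 'v) gl_struct = "('k, 'v) module" +
  act :: "'k mat \<Rightarrow> 'v \<Rightarrow> 'v"

locale gl_module =
  fixes n :: nat and M :: "('k::field, 'v) gl_struct"
  assumes vectorspace: "vectorspace class_ring M"
    and act_linear: "g \<in> GL n \<Longrightarrow> act M g \<in> LinearCombinations.module_hom class_ring M M"
    and act_one: "v \<in> carrier M \<Longrightarrow> act M (1\<^sub>m n) v = v"
    and act_mult: "g \<in> GL n \<Longrightarrow> h \<in> GL n \<Longrightarrow> v \<in> carrier M \<Longrightarrow>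
      act M (g * h) v = act M g (act M h v)"

definition gl_isomorphic ::
    "nat \<Rightarrow> ('k::field, 'v) gl_struct \<Rightarrow> ('k, 'w) gl_struct \<Rightarrow> bool"
  where "gl_isomorphic n M N \<longleftrightarrow>
    (\<exists>h \<in> LinearCombinations.module_hom class_ring M N. bij_betw h (carrier M) (carrier N) \<and>
      (\<forall>g \<in> GL n. \<forall>v \<in> carrier M. h (act M g v) = act N g (h v)))"

text \<open>The external direct sum; its ring multiplication and unit are irrelevant.\<close>

definition gl_direct_sum ::
    "'i set \<Rightarrow> ('i \<Rightarrow> ('k::field, 'v) gl_struct) \<Rightarrow> ('k, 'i \<Rightarrow> 'v) gl_struct"
  where "gl_direct_sum I M =
    \<lparr>carrier = {f \<in> (\<Pi>\<^sub>E i\<in>I. carrier (M i)). finite {i \<in> I. f i \<noteq> \<zero>\<^bsub>M i\<^esub>}},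
     mult = undefined, one = undefined,
     zero = (\<lambda>i\<in>I. \<zero>\<^bsub>M i\<^esub>),
     add = (\<lambda>f f'. \<lambda>i\<in>I. f i \<oplus>\<^bsub>M i\<^esub> f' i),
     smult = (\<lambda>c f. \<lambda>i\<in>I. c \<odot>\<^bsub>M i\<^esub> f i),
     act = (\<lambda>g f. \<lambda>i\<in>I. act (M i) g (f i))\<rparr>"

definition gl_irreducible :: "nat \<Rightarrow> ('k::field, 'v) gl_struct \<Rightarrow> bool"
  where "gl_irreducible n M \<longleftrightarrow> gl_module n M \<and> carrier M \<noteq> {\<zero>\<^bsub>M\<^esub>} \<and>
    (\<forall>W. VectorSpace.subspace class_ring W M \<and> (\<forall>g \<in> GL n. \<forall>w \<in> W. act M g w \<in> W)
      \<longrightarrow> W = {\<zero>\<^bsub>M\<^esub>} \<or> W = carrier M)"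

text \<open>Functions of a matrix that are polynomials in its \<open>n\<^sup>2\<close> entries.\<close>

inductive_set entry_polys :: "nat \<Rightarrow> ('k::field mat \<Rightarrow> 'k) set" for n where
  const: "(\<lambda>g. c) \<in> entry_polys n"
| entry: "i < n \<Longrightarrow> j < n \<Longrightarrow> (\<lambda>g. g $$ (i, j)) \<in> entry_polys n"
| add: "p \<in> entry_polys n \<Longrightarrow> q \<in> entry_polys n \<Longrightarrow> (\<lambda>g. p g + q g) \<in> entry_polys n"
| mult: "p \<in> entry_polys n \<Longrightarrow> q \<in> entry_polys n \<Longrightarrow> (\<lambda>g. p g * q g) \<in> entry_polys n"

text \<open>
  A polynomial module is finite-dimensional, and in some basis the matrix coefficients of the
  action are polynomial functions of the matrix entries.
\<close>

definition gl_polynomial :: "nat \<Rightarrow> ('k::field, 'v) gl_struct \<Rightarrow> bool"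
  where "gl_polynomial n M \<longleftrightarrow> gl_module n M \<and>
    (\<exists>B p. finite B \<and> vectorspace.basis class_ring M B \<and>
      (\<forall>b \<in> B. \<forall>c \<in> B. p c b \<in> entry_polys n) \<and>
      (\<forall>g \<in> GL n. \<forall>b \<in> B. act M g b = (\<Oplus>\<^bsub>M\<^esub>c\<in>B. p c b g \<odot>\<^bsub>M\<^esub> c)))"

text \<open>
  Partitions with at most \<open>n\<close> parts, padded with zeros to length \<open>n\<close>; the part \<open>\<lambda>\<^sub>i\<close> is
  \<open>lam ! (i - 1)\<close>.
\<close>

definition partitions :: "nat \<Rightarrow> nat list set"
  where "partitions n = {lam. length lam = n \<and> sorted_wrt (\<ge>) lam}"

text \<open>
  A highest weight vector spans a line on which the upper triangular Borel subgroup acts by the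
  character \<open>b \<mapsto> \<Prod>i. b\<^sub>i\<^sub>i ^ \<lambda>\<^sub>i\<close>; equivalently, it is fixed by the upper unitriangular matrices and
  has weight \<open>\<lambda>\<close> for the diagonal torus.
\<close>

definition has_highest_weight :: "nat \<Rightarrow> nat list \<Rightarrow> ('k::field, 'v) gl_struct \<Rightarrow> bool"
  where "has_highest_weight n lam M \<longleftrightarrow>
    (\<exists>v \<in> carrier M. v \<noteq> \<zero>\<^bsub>M\<^esub> \<and>
      (\<forall>b \<in> GL n. upper_triangular b \<longrightarrow>
        act M b v = (\<Prod>i<n. b $$ (i, i) ^ (lam ! i)) \<odot>\<^bsub>M\<^esub> v))"

text \<open>\<open>M\<close> is (a model of) the irreducible polynomial module \<open>V\<^sub>\<lambda>\<close>.\<close>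

definition is_V :: "nat \<Rightarrow> nat list \<Rightarrow> ('k::field, 'v) gl_struct \<Rightarrow> bool"
  where "is_V n lam M \<longleftrightarrow>
    gl_irreducible n M \<and> gl_polynomial n M \<and> has_highest_weight n lam M"


section \<open>The relatively free algebra as a \<open>GL(n)\<close>-module\<close>

text \<open>
  The algebra automorphism of the free algebra that extends \<open>x\<^sub>j \<mapsto> \<Sum>i. g\<^sub>i\<^sub>j x\<^sub>i\<close>.
\<close>

definition free_act :: "nat \<Rightarrow> 'k::field mat \<Rightarrow> 'k free_alg \<Rightarrow> 'k free_alg"
  where "free_act n g f =
    (\<Sum>w \<in> Poly_Mapping.keys f. scalar (Poly_Mapping.lookup f w) *
      prod_list (map (\<lambda>j. \<Sum>i<n. scalar (g $$ (i, j)) * gen i) (letters w)))"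

text \<open>
  Elements of the quotient are cosets. Scalars act through their classes in the quotient
  algebra, and a matrix sends a coset to its image; this is a coset again because the ideal is
  stable under \<open>GL(n)\<close>.
\<close>

definition rel_free_nilp :: "nat \<Rightarrow> nat \<Rightarrow> ('k::field, 'k free_alg set) gl_struct"
  where "rel_free_nilp n p =
    (let R = free_algebra n; I = comm_ideal n (p + 1); Q = R Quot I in
     \<lparr>carrier = carrier Q, mult = mult Q, one = one Q, zero = zero Q, add = add Q,
      smult = (\<lambda>c A. (I +>\<^bsub>R\<^esub> scalar c) \<otimes>\<^bsub>Q\<^esub> A),
      act = (\<lambda>g A. free_act n g ` A)\<rparr>)"

end

theory Submission
  imports Defs
begin

text \<open>
  A highest weight vector \<open>f\<close> of weight \<open>\<lambda>\<close> is, modulo the \<open>T\<close>-ideal \<open>I = I\<^bsub>p+1\<^esub>\<close>, homogeneous of degree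
  \<open>\<lambda>\<^sub>2\<close> in \<open>x\<^sub>2\<close> and killed by the derivation \<open>\<delta>\<close> that maps \<open>x\<^sub>2\<close> to \<open>x\<^sub>1\<close> and the other generators to \<open>0\<close>.
  The ideal \<open>I\<close> is stable under all derivations, in particular under the partial derivatives \<open>\<partial>\<^sub>i\<close>
  that map \<open>x\<^sub>i\<close> to \<open>1\<close> and the other generators to \<open>0\<close>. If \<open>f \<notin> I\<close>, let \<open>g = \<partial>\<^sub>1\<^sup>m f\<close> be the last iterated derivative outside \<open>I\<close>; then
  \<open>[\<partial>\<^sub>1, \<delta>] = \<partial>\<^sub>2\<close> gives \<open>\<partial>\<^sub>2 g \<in> I\<close>.

  Write \<open>x = x\<^sub>2\<close> and let \<open>A(g)\<close> be obtained from \<open>g\<close> by replacing each left multiplication by \<open>x\<close> with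
  \<open>ad x\<close> and applying the result to \<open>1\<close>. Since \<open>ad x\<close> is left minus right multiplication by \<open>x\<close>, and the
  latter commutes with everything involved, \<open>A(g) = \<Sum>\<^sub>k (-1)\<^sup>k/k! \<cdot> \<partial>\<^sub>2\<^sup>k(g) x\<^sup>k\<close>, so \<open>A(g)\<close> and \<open>g\<close> agree
  modulo \<open>I\<close>. On the other hand \<open>A(g)\<close> is a combination of nested products
  \<open>y\<^sub>0 [x, y\<^sub>1 [x, y\<^sub>2 [x, \<dots>]]]\<close> with \<open>\<lambda>\<^sub>2\<close> brackets, and such a product with at least \<open>p\<close> brackets lies in
  \<open>I\<close>. Hence \<open>\<lambda>\<^sub>2 \<ge> p\<close> would force \<open>g \<in> I\<close>.
\<close>

section \<open>Linear maps on the free algebra\<close>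

definition word_mon :: "nat list \<Rightarrow> 'k::field free_alg"
  where "word_mon ws = Poly_Mapping.single (Word ws) 1"

text \<open>The derivations, the adjoint replacement, the homogeneous projections and the group
  action are all built this way, so identities between them need checking only on words, by
  induction on the list of letters.\<close>

definition lin_ext :: "(nat list \<Rightarrow> 'k free_alg) \<Rightarrow> 'k::field free_alg \<Rightarrow> 'k free_alg"
  where "lin_ext F f =
    (\<Sum>w \<in> Poly_Mapping.keys f. scalar (Poly_Mapping.lookup f w) * F (letters w))"

text \<open>Scalars are elements of the algebra, and the maps are total on words in all of
  \<open>nat\<close>; the restriction to n generators is tracked separately by membership in
  \<open>FA n\<close>.\<close>

definition klinear :: "('k::field free_alg \<Rightarrow> 'k free_alg) \<Rightarrow> bool"
  where "klinear T \<longleftrightarrow> (\<forall>f g. T (f + g) = T f + T g) \<and> (\<forall>c f. T (scalar c * f) = scalar c * T f)"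

lemma scalar_0 [simp]: "scalar 0 = 0" and scalar_1 [simp]: "scalar 1 = 1"
  and scalar_add: "scalar (a + b) = scalar a + scalar b"
  and scalar_mult: "scalar (a * b) = scalar a * scalar b"
  and scalar_uminus: "scalar (- a) = - scalar a"
  and scalar_diff: "scalar (a - b) = scalar a - scalar b"
  by (simp_all add: scalar_def single_add mult_single single_uminus single_diff)

lemma scalar_of_nat: "scalar (of_nat n) = of_nat n"
  by (simp add: scalar_def)

lemma word_mon_Nil: "word_mon [] = 1"
  by (simp add: word_mon_def flip: zero_free_word_def)

lemma word_mon_append: "word_mon (u @ v) = word_mon u * word_mon v"
  by (simp add: word_mon_def mult_single plus_free_word_def)

lemma word_mon_Cons: "word_mon (j # v) = gen j * word_mon v"
  by (simp add: word_mon_def gen_def mult_single plus_free_word_def)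

lemma gen_eq_word_mon: "gen j = word_mon [j]"
  by (simp add: gen_def word_mon_def)

lemma single_eq_scalar: "Poly_Mapping.single w c = scalar c * word_mon (letters w)"
  by (simp add: scalar_def word_mon_def mult_single)

lemma free_alg_expand:
  "f = (\<Sum>w \<in> Poly_Mapping.keys f. scalar (Poly_Mapping.lookup f w) * word_mon (letters w))"
proof (rule poly_mapping_eqI)
  fix v
  show "Poly_Mapping.lookup f v = Poly_Mapping.lookup
    (\<Sum>w \<in> Poly_Mapping.keys f. scalar (Poly_Mapping.lookup f w) * word_mon (letters w)) v"
    by (simp add: lookup_sum lookup_single when_def in_keys_iff flip: single_eq_scalar)
qed

lemma free_alg_induct [case_names word add scale]:
  assumes "\<And>ws. P (word_mon ws)" and "\<And>f g. P f \<Longrightarrow> P g \<Longrightarrow> P (f + g)"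
    and "\<And>c f. P f \<Longrightarrow> P (scalar c * f)"
  shows "P f"
proof -
  have P0: "P 0" using assms(3)[OF assms(1)[of "[]"], of 0] by simp
  have "P (\<Sum>w \<in> A. scalar (Poly_Mapping.lookup f w) * word_mon (letters w))" for A
    by (induction A rule: infinite_finite_induct) (auto simp: P0 intro: assms)
  then show ?thesis using free_alg_expand[of f] by metis
qed

lemma scalar_comm: "f * scalar c = scalar c * f"
proof (induction f rule: free_alg_induct)
  case (word ws)
  then show ?case by (simp add: scalar_def word_mon_def mult_single)
next
  case (add f g)
  then show ?case by (simp add: algebra_simps)
next
  case (scale a f)
  have "scalar a * scalar c = scalar c * scalar a"
    by (metis scalar_mult mult.commute)
  then show ?case by (metis mult.assoc scale)
qed

lemma scalar_left_comm: "f * (scalar c * g) = scalar c * (f * g)"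
  by (metis scalar_comm mult.assoc)

lemma klinear_add: "klinear T \<Longrightarrow> T (f + g) = T f + T g"
  and klinear_scale: "klinear T \<Longrightarrow> T (scalar c * f) = scalar c * T f"
  by (simp_all add: klinear_def)

lemma klinear_0: "klinear T \<Longrightarrow> T 0 = 0"
  using klinear_scale[of T 0 0] by simp

lemma klinear_uminus: "klinear T \<Longrightarrow> T (- f) = - T f"
  by (metis add_eq_0_iff klinear_0 klinear_add)

lemma klinear_diff: "klinear T \<Longrightarrow> T (f - g) = T f - T g"
  using klinear_add[of T f "- g"] by (simp add: klinear_uminus)

lemma klinear_sum: "klinear T \<Longrightarrow> T (sum g A) = (\<Sum>i\<in>A. T (g i))"
  by (induction A rule: infinite_finite_induct) (simp_all add: klinear_0 klinear_add)

lemma klinear_comp: "klinear S \<Longrightarrow> klinear T \<Longrightarrow> klinear (\<lambda>f. S (T f))"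
  by (simp add: klinear_def)

lemma klinear_plus: "klinear S \<Longrightarrow> klinear T \<Longrightarrow> klinear (\<lambda>f. S f + T f)"
  by (simp add: klinear_def algebra_simps)

lemma klinear_lmult: "klinear T \<Longrightarrow> klinear (\<lambda>f. a * T f)"
  by (simp add: klinear_def distrib_left scalar_left_comm)

lemma klinear_rmult: "klinear T \<Longrightarrow> klinear (\<lambda>f. T f * a)"
  by (simp add: klinear_def distrib_right mult.assoc)

lemma klinear_zero: "klinear (\<lambda>f. 0)"
  by (simp add: klinear_def)

lemma klinear_id: "klinear (\<lambda>f. f)"
  by (simp add: klinear_def)

lemma klinear_sum_fun: "(\<And>i. i \<in> A \<Longrightarrow> klinear (T i)) \<Longrightarrow> klinear (\<lambda>f. \<Sum>i\<in>A. T i f)"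
  by (simp add: klinear_def sum.distrib sum_distrib_left)

lemma klinear_funpow: "klinear T \<Longrightarrow> klinear (T ^^ k)"
  by (induction k) (simp_all add: klinear_def)

lemma klinear_eqI:
  assumes "klinear S" "klinear T" "\<And>ws. S (word_mon ws) = T (word_mon ws)"
  shows "S f = T f"
  by (induction f rule: free_alg_induct) (simp_all add: assms klinear_add klinear_scale)

text \<open>Cancellation can make the keys of a sum smaller than the union of the keys of its terms.
  Over a common index set, additivity is just addition of coefficients.\<close>

lemma lin_ext_superset:
  assumes "finite A" "Poly_Mapping.keys f \<subseteq> A"
  shows "lin_ext F f = (\<Sum>w \<in> A. scalar (Poly_Mapping.lookup f w) * F (letters w))"
  unfolding lin_ext_def
  by (rule sum.mono_neutral_left) (use assms in \<open>auto simp: in_keys_iff\<close>)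

lemma klinear_lin_ext: "klinear (lin_ext F)"
  unfolding klinear_def
proof (intro conjI allI)
  fix f g :: "'a free_alg" and c :: 'a
  let ?A = "Poly_Mapping.keys f \<union> Poly_Mapping.keys g"
  show "lin_ext F (f + g) = lin_ext F f + lin_ext F g"
    using keys_add[of f g]
    by (simp add: lin_ext_superset[of ?A] lookup_add scalar_add distrib_right sum.distrib)
  have "scalar c * f = Poly_Mapping.map ((*) c) f"
    by (simp add: scalar_def mult_map_scale_conv_mult)
  then have l: "Poly_Mapping.lookup (scalar c * f) w = c * Poly_Mapping.lookup f w" for w
    by (simp add: map.rep_eq when_def)
  have "Poly_Mapping.keys (scalar c * f) \<subseteq> Poly_Mapping.keys f"
    by (auto simp: in_keys_iff l)
  then show "lin_ext F (scalar c * f) = scalar c * lin_ext F f"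
    by (simp add: lin_ext_superset[of "Poly_Mapping.keys f"] l scalar_mult sum_distrib_left mult.assoc)
qed

lemma lin_ext_word [simp]: "lin_ext F (word_mon ws) = F ws"
  by (simp add: lin_ext_def word_mon_def)

lemma lin_ext_cong:
  "(\<And>w. w \<in> Poly_Mapping.keys f \<Longrightarrow> F (letters w) = G (letters w)) \<Longrightarrow> lin_ext F f = lin_ext G f"
  by (simp add: lin_ext_def)

text \<open>For identities that hold only on some words, such as words of bounded length or in the
  first n letters: a linear map sees \<open>f\<close> only through its values on the words of
  \<open>f\<close>.\<close>

lemma klinear_eq_on_keys:
  assumes "klinear S" "klinear T"
    and "\<And>w. w \<in> Poly_Mapping.keys f \<Longrightarrow> S (word_mon (letters w)) = T (word_mon (letters w))"
  shows "S f = T f"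
proof -
  have "S f = lin_ext (\<lambda>ws. S (word_mon ws)) f"
    by (rule klinear_eqI) (simp_all add: assms klinear_lin_ext)
  also have "\<dots> = lin_ext (\<lambda>ws. T (word_mon ws)) f"
    by (rule lin_ext_cong) (rule assms)
  also have "\<dots> = T f"
    by (rule klinear_eqI[symmetric]) (simp_all add: assms klinear_lin_ext)
  finally show ?thesis .
qed

section \<open>Derivations\<close>

primrec deriv_word :: "(nat \<Rightarrow> 'k free_alg) \<Rightarrow> nat list \<Rightarrow> 'k::field free_alg"
  where "deriv_word \<phi> [] = 0"
  | "deriv_word \<phi> (j # ws) = \<phi> j * word_mon ws + gen j * deriv_word \<phi> ws"

definition deriv_ext :: "(nat \<Rightarrow> 'k free_alg) \<Rightarrow> 'k::field free_alg \<Rightarrow> 'k free_alg"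
  where "deriv_ext \<phi> = lin_ext (deriv_word \<phi>)"

lemma klinear_deriv_ext: "klinear (deriv_ext \<phi>)"
  unfolding deriv_ext_def by (rule klinear_lin_ext)

lemmas deriv_ext_add = klinear_add[OF klinear_deriv_ext]
  and deriv_ext_diff = klinear_diff[OF klinear_deriv_ext]
  and deriv_ext_scale = klinear_scale[OF klinear_deriv_ext]

lemma deriv_ext_word: "deriv_ext \<phi> (word_mon ws) = deriv_word \<phi> ws"
  by (simp add: deriv_ext_def)

lemma deriv_word_append:
  "deriv_word \<phi> (u @ v) = deriv_word \<phi> u * word_mon v + word_mon u * deriv_word \<phi> v"
  by (induction u) (simp_all add: word_mon_Nil word_mon_Cons word_mon_append algebra_simps)

text \<open>Both sides are bilinear, so concatenations of words suffice; linearity is used in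
  \<open>g\<close> first, with a word in place of \<open>f\<close>.\<close>

lemma deriv_ext_mult: "deriv_ext \<phi> (f * g) = deriv_ext \<phi> f * g + f * deriv_ext \<phi> g"
proof -
  have *: "deriv_ext \<phi> (word_mon u * g) = deriv_ext \<phi> (word_mon u) * g + word_mon u * deriv_ext \<phi> g"
    for u
    by (rule klinear_eqI)
      (simp_all add: klinear_comp klinear_plus klinear_lmult klinear_deriv_ext klinear_id
        deriv_ext_word deriv_word_append flip: word_mon_append)
  show ?thesis
    by (rule klinear_eqI[where f = f])
      (simp_all add: * klinear_def deriv_ext_add deriv_ext_scale distrib_right distrib_left mult.assoc)
qed

lemma deriv_ext_gen: "deriv_ext \<phi> (gen j) = \<phi> j"
  by (simp add: gen_eq_word_mon deriv_ext_word word_mon_Nil)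

lemma deriv_ext_1: "deriv_ext \<phi> 1 = 0"
  using deriv_ext_word[of \<phi> "[]"] by (simp add: word_mon_Nil)

text \<open>The commutator of two derivations is a derivation, because the mixed Leibniz terms
  cancel. Hence its values on the generators, which the assumption prescribes, determine it.\<close>

lemma deriv_ext_commute:
  assumes "\<And>j. deriv_ext \<phi> (\<psi> j) - deriv_ext \<psi> (\<phi> j) = \<chi> j"
  shows "deriv_ext \<phi> (deriv_ext \<psi> f) - deriv_ext \<psi> (deriv_ext \<phi> f) = deriv_ext \<chi> f"
proof (rule klinear_eqI[where f = f])
  fix ws :: "nat list"
  show "deriv_ext \<phi> (deriv_ext \<psi> (word_mon ws)) - deriv_ext \<psi> (deriv_ext \<phi> (word_mon ws)) =
      deriv_ext \<chi> (word_mon ws)"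
  proof (induction ws)
    case (Cons j ws)
    have "deriv_ext \<phi> (deriv_ext \<psi> (word_mon (j # ws))) - deriv_ext \<psi> (deriv_ext \<phi> (word_mon (j # ws))) =
        (deriv_ext \<phi> (\<psi> j) - deriv_ext \<psi> (\<phi> j)) * word_mon ws
        + gen j * (deriv_ext \<phi> (deriv_ext \<psi> (word_mon ws)) - deriv_ext \<psi> (deriv_ext \<phi> (word_mon ws)))"
      by (simp add: word_mon_Cons deriv_ext_mult deriv_ext_add deriv_ext_gen algebra_simps)
    also have "\<dots> = deriv_ext \<chi> (word_mon (j # ws))"
      unfolding Cons assms by (simp add: word_mon_Cons deriv_ext_mult deriv_ext_gen)
    finally show ?case .
  qed (simp add: word_mon_Nil deriv_ext_1 klinear_0[OF klinear_deriv_ext])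
qed (simp_all add: klinear_def deriv_ext_add deriv_ext_scale algebra_simps)

section \<open>Partial derivatives with respect to a generator\<close>

definition pderiv_gen :: "nat \<Rightarrow> 'k::field free_alg \<Rightarrow> 'k free_alg"
  where "pderiv_gen a = deriv_ext (\<lambda>j. if j = a then 1 else 0)"

lemma klinear_pderiv_gen: "klinear (pderiv_gen a)"
  unfolding pderiv_gen_def by (rule klinear_deriv_ext)

text \<open>The second derivative of a generator vanishes, so the iterated Leibniz rule has only two
  terms. At \<open>k = 0\<close> the coefficient 0 absorbs the truncated exponent
  \<open>k - 1\<close>.\<close>

lemma funpow_pderiv_gen_lmult:
  "(pderiv_gen a ^^ k) (gen j * f) =
    gen j * (pderiv_gen a ^^ k) f + (if j = a then of_nat k * (pderiv_gen a ^^ (k - 1)) f else 0)"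
proof (induction k)
  case (Suc k)
  have s: "pderiv_gen a (of_nat k * g) = of_nat k * pderiv_gen a g" for g :: "'a free_alg"
    by (metis klinear_pderiv_gen klinear_scale scalar_of_nat)
  show ?case
  proof (cases "j = a")
    case True
    then have IH: "(pderiv_gen a ^^ k) (gen a * f) =
        gen a * (pderiv_gen a ^^ k) f + of_nat k * (pderiv_gen a ^^ (k - 1)) f"
      using Suc by simp
    have "(pderiv_gen a ^^ Suc k) (gen a * f) =
        (pderiv_gen a ^^ k) f + gen a * (pderiv_gen a ^^ Suc k) f
        + of_nat k * pderiv_gen a ((pderiv_gen a ^^ (k - 1)) f)"
      by (simp only: funpow.simps o_apply IH klinear_add[OF klinear_pderiv_gen] s)
        (simp add: pderiv_gen_def deriv_ext_mult deriv_ext_gen)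
    also have "of_nat k * pderiv_gen a ((pderiv_gen a ^^ (k - 1)) f) = of_nat k * (pderiv_gen a ^^ k) f"
      by (cases k) simp_all
    finally show ?thesis using True by (simp add: algebra_simps)
  next
    case False
    then show ?thesis
      by (simp add: Suc) (simp add: pderiv_gen_def deriv_ext_mult deriv_ext_gen)
  qed
qed simp

text \<open>Each derivative deletes one letter. This makes \<open>pderiv_gen a\<close> locally
  nilpotent and lets the exponential sums below be truncated.\<close>

lemma funpow_pderiv_gen_word: "length ws < k \<Longrightarrow> (pderiv_gen a ^^ k) (word_mon ws) = 0"
proof (induction ws arbitrary: k)
  case Nil
  then obtain l where "k = Suc l" by (cases k) auto
  moreover have "(pderiv_gen a ^^ l) 0 = 0"
    using klinear_0[OF klinear_funpow[OF klinear_pderiv_gen]] .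
  ultimately show ?case
    by (simp add: funpow_swap1 word_mon_Nil) (simp add: pderiv_gen_def deriv_ext_1)
next
  case (Cons j ws)
  then have "length ws < k" "length ws < k - 1" by simp_all
  then show ?case by (simp add: word_mon_Cons funpow_pderiv_gen_lmult Cons.IH)
qed

lemma ex_length_bound:
  obtains N where "\<And>w. w \<in> Poly_Mapping.keys f \<Longrightarrow> length (letters w) < N"
proof -
  have "finite ((\<lambda>w. length (letters w)) ` Poly_Mapping.keys f)" by simp
  then obtain N where "\<forall>k \<in> (\<lambda>w. length (letters w)) ` Poly_Mapping.keys f. k < N"
    using finite_nat_set_iff_bounded by blast
  then show thesis using that by blast
qed

lemma pderiv_gen_nilpotent: "\<exists>N. (pderiv_gen a ^^ N) f = 0"
proof -
  obtain N where "\<And>w. w \<in> Poly_Mapping.keys f \<Longrightarrow> length (letters w) < N"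
    using ex_length_bound by blast
  then have "(pderiv_gen a ^^ N) f = 0"
    using klinear_eq_on_keys[OF klinear_funpow[OF klinear_pderiv_gen] klinear_zero]
    by (metis funpow_pderiv_gen_word)
  then show ?thesis ..
qed

section \<open>Replacing a generator by its adjoint action\<close>

primrec ad_word :: "nat \<Rightarrow> nat list \<Rightarrow> 'k::field free_alg"
  where "ad_word a [] = 1"
  | "ad_word a (j # ws) = gen j * ad_word a ws - (if j = a then ad_word a ws * gen a else 0)"

text \<open>Induction on the word. The Leibniz rule splits the sum for \<open>j # ws\<close> into
  \<open>gen j\<close> times the sum for \<open>ws\<close> and, if \<open>j = a\<close>, a sum that
  becomes minus the sum for \<open>ws\<close> times \<open>gen a\<close> after an index shift. Any
  bound \<open>N\<close> above the length is allowed because the shifted sum has one term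
  fewer.\<close>

lemma ad_word_eq:
  fixes a :: nat
  defines "c \<equiv> \<lambda>k. scalar ((- 1) ^ k / fact k) :: 'k::field_char_0 free_alg"
  assumes "length ws < N"
  shows "ad_word a ws = (\<Sum>k<N. c k * ((pderiv_gen a ^^ k) (word_mon ws) * gen a ^ k))"
  using assms(2)
proof (induction ws arbitrary: N)
  case Nil
  then have "(\<Sum>k<N. c k * ((pderiv_gen a ^^ k) (word_mon []) * gen a ^ k)) =
      (\<Sum>k\<in>{0}. c k * ((pderiv_gen a ^^ k) (word_mon []) * gen a ^ k))"
    by (intro sum.mono_neutral_right) (auto simp: funpow_pderiv_gen_word)
  then show ?case by (simp add: c_def word_mon_Nil)
next
  case (Cons j ws)
  obtain M where N: "N = Suc M" "length ws < M" using Cons.prems by (cases N) auto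
  let ?s = "\<lambda>k. (pderiv_gen a ^^ k) (word_mon ws) :: 'k free_alg"
  \<comment> \<open>The recursion of the exponential coefficients; dividing by \<open>Suc k\<close>
    requires characteristic 0.\<close>
  have c: "c (Suc k) * of_nat (Suc k) = - c k" for k
  proof -
    have "c (Suc k) * of_nat (Suc k) = scalar ((- 1) ^ Suc k / fact (Suc k) * of_nat (Suc k))"
      by (simp only: c_def scalar_mult scalar_of_nat)
    also have "(- 1) ^ Suc k / fact (Suc k) * of_nat (Suc k) = - ((- 1) ^ k / fact k :: 'k)"
      by (simp add: field_simps del: of_nat_Suc)
    finally show ?thesis by (simp add: c_def scalar_uminus)
  qed
  have cg: "c k * (gen j * u) = gen j * (c k * u)" for k u
    unfolding c_def by (simp add: scalar_left_comm)
  have "(\<Sum>k<N. c k * ((pderiv_gen a ^^ k) (word_mon (j # ws)) * gen a ^ k)) =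
      gen j * (\<Sum>k<N. c k * (?s k * gen a ^ k))
      + (\<Sum>k<N. if j = a then c k * of_nat k * (?s (k - 1) * gen a ^ k) else 0)"
    by (simp add: word_mon_Cons funpow_pderiv_gen_lmult sum_distrib_left distrib_left distrib_right
        sum.distrib mult.assoc cg if_distrib[of "\<lambda>u. u * _"] if_distrib[of "\<lambda>u. _ * u"] cong: if_cong)
  \<comment> \<open>The term at index 0 vanishes through the factor \<open>of_nat 0\<close>; the
    others are reindexed from \<open>Suc k\<close> to \<open>k\<close>.\<close>
  also have "(\<Sum>k<N. if j = a then c k * of_nat k * (?s (k - 1) * gen a ^ k) else 0) =
      - (if j = a then (\<Sum>k<M. c k * (?s k * gen a ^ k)) * gen a else 0)"
    unfolding N sum.lessThan_Suc_shift
    by (simp add: c sum_distrib_right sum_negf mult.assoc power_commutes del: of_nat_Suc)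
  also have "(\<Sum>k<N. c k * (?s k * gen a ^ k)) = ad_word a ws"
    using Cons.IH[of N] N by simp
  also have "(\<Sum>k<M. c k * (?s k * gen a ^ k)) = ad_word a ws"
    using Cons.IH[of M] N by simp
  finally show ?case by simp
qed

section \<open>The commutator ideals\<close>

abbreviation FA :: "nat \<Rightarrow> 'k::field free_alg set"
  where "FA n \<equiv> carrier (free_algebra n)"

lemma free_algebra_simps [simp]:
  "mult (free_algebra n) = (*)" "one (free_algebra n) = 1"
  "zero (free_algebra n) = 0" "add (free_algebra n) = (+)"
  by (simp_all add: free_algebra_def)

lemma FA_iff: "f \<in> FA n \<longleftrightarrow> (\<forall>w \<in> Poly_Mapping.keys f. set (letters w) \<subseteq> {..<n})"
  by (simp add: free_algebra_def)

lemma FA_0 [simp]: "0 \<in> FA n" and FA_1 [simp]: "1 \<in> FA n"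
  and FA_scalar [simp]: "scalar c \<in> FA n"
  and FA_word: "set ws \<subseteq> {..<n} \<Longrightarrow> word_mon ws \<in> FA n"
  by (auto simp: FA_iff scalar_def word_mon_def zero_free_word_def)

lemma FA_gen: "j < n \<Longrightarrow> gen j \<in> FA n"
  by (simp add: gen_eq_word_mon FA_word)

lemma FA_add: "f \<in> FA n \<Longrightarrow> g \<in> FA n \<Longrightarrow> f + g \<in> FA n"
  using keys_add[of f g] by (fastforce simp: FA_iff)

lemma FA_mult: "f \<in> FA n \<Longrightarrow> g \<in> FA n \<Longrightarrow> f * g \<in> FA n"
  using keys_mult[of f g] by (fastforce simp: FA_iff plus_free_word_def)

lemma FA_uminus: "f \<in> FA n \<Longrightarrow> - f \<in> FA n"
  using FA_mult[OF FA_scalar[of "- 1"], of f] by (simp add: scalar_uminus)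

lemma FA_diff: "f \<in> FA n \<Longrightarrow> g \<in> FA n \<Longrightarrow> f - g \<in> FA n"
  using FA_add[OF _ FA_uminus, of f n g] by simp

lemma FA_sum: "(\<And>i. i \<in> A \<Longrightarrow> g i \<in> FA n) \<Longrightarrow> sum g A \<in> FA n"
  by (induction A rule: infinite_finite_induct) (simp_all add: FA_add)

lemma FA_power: "f \<in> FA n \<Longrightarrow> f ^ k \<in> FA n"
  by (induction k) (simp_all add: FA_mult)

lemma FA_lin_ext:
  assumes "f \<in> FA n" "\<And>ws. set ws \<subseteq> {..<n} \<Longrightarrow> F ws \<in> FA n"
  shows "lin_ext F f \<in> FA n"
  unfolding lin_ext_def using assms by (intro FA_sum FA_mult) (auto simp: FA_iff[of f])

lemma FA_deriv_ext:
  assumes "f \<in> FA n" "\<And>j. j < n \<Longrightarrow> \<phi> j \<in> FA n"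
  shows "deriv_ext \<phi> f \<in> FA n"
proof -
  have "deriv_word \<phi> ws \<in> FA n" if "set ws \<subseteq> {..<n}" for ws
    using that by (induction ws) (simp_all add: FA_add FA_mult FA_gen FA_word assms)
  then show ?thesis unfolding deriv_ext_def by (rule FA_lin_ext[OF assms(1)])
qed

lemma klinear_eq_on_FA:
  assumes "klinear S" "klinear T" "f \<in> FA n"
    and "\<And>ws. set ws \<subseteq> {..<n} \<Longrightarrow> S (word_mon ws) = T (word_mon ws)"
  shows "S f = T f"
  using assms by (intro klinear_eq_on_keys[of S T f]) (auto simp: FA_iff)

lemma ring_free_algebra: "ring (free_algebra n)"
proof (rule ringI)
  show "abelian_group (free_algebra n :: 'k::field free_alg ring)"
  proof (rule abelian_groupI)
    fix x :: "'k free_alg" assume "x \<in> FA n"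
    then show "\<exists>y\<in>FA n. y \<oplus>\<^bsub>free_algebra n\<^esub> x = \<zero>\<^bsub>free_algebra n\<^esub>"
      by (intro bexI[of _ "- x"]) (simp_all add: FA_uminus)
  qed (simp_all add: FA_add algebra_simps)
  show "Group.monoid (free_algebra n :: 'k::field free_alg ring)"
    by (rule monoidI) (simp_all add: FA_mult mult.assoc)
qed (simp_all add: algebra_simps)

lemma a_inv_free_algebra:
  fixes x :: "'k::field free_alg"
  assumes "x \<in> FA n" shows "\<ominus>\<^bsub>free_algebra n\<^esub> x = - x"
proof -
  interpret ring "free_algebra n :: 'k free_alg ring" by (rule ring_free_algebra)
  from assms show ?thesis by (intro minus_equality) (simp_all add: FA_uminus)
qed

text \<open>Closure under negation comes from multiplication by \<open>scalar (- 1)\<close>, which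
  lies in the carrier.\<close>

lemma ideal_free_algebraI:
  fixes J :: "'k::field free_alg set"
  assumes "J \<subseteq> FA n" "0 \<in> J" "\<And>f g. f \<in> J \<Longrightarrow> g \<in> J \<Longrightarrow> f + g \<in> J"
    and "\<And>a f. a \<in> FA n \<Longrightarrow> f \<in> J \<Longrightarrow> a * f \<in> J" "\<And>a f. a \<in> FA n \<Longrightarrow> f \<in> J \<Longrightarrow> f * a \<in> J"
  shows "ideal J (free_algebra n)"
proof (rule idealI[OF ring_free_algebra])
  interpret ring "free_algebra n :: 'k free_alg ring" by (rule ring_free_algebra)
  have neg: "- f \<in> J" if "f \<in> J" for f
    using assms(4)[OF FA_scalar[of "- 1"] that] by (simp add: scalar_uminus)
  have "\<ominus>\<^bsub>free_algebra n\<^esub> f \<in> J" if "f \<in> J" for f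
    using that assms(1) neg a_inv_free_algebra[of f n] by auto
  with assms show "subgroup J (add_monoid (free_algebra n))"
    by (intro add.subgroupI) auto
qed (use assms in simp_all)

lemma FA_left_normed_comm:
  fixes us :: "'k::field free_alg list"
  assumes "us \<noteq> []" "set us \<subseteq> FA n" shows "left_normed_comm us \<in> FA n"
proof -
  have "foldl (\<lambda>u v. u * v - v * u) u vs \<in> FA n" if "u \<in> FA n" "set vs \<subseteq> FA n"
    for u and vs :: "'k free_alg list"
    using that by (induction vs arbitrary: u) (simp_all add: FA_diff FA_mult)
  with assms show ?thesis unfolding left_normed_comm_def by (cases us) simp_all
qed

lemma left_normed_comm_snoc:
  "us \<noteq> [] \<Longrightarrow> left_normed_comm (us @ [u]) = left_normed_comm us * u - u * left_normed_comm us"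
  by (simp add: left_normed_comm_def)

lemma left_normed_comm_append:
  "us \<noteq> [] \<Longrightarrow> left_normed_comm (us @ vs) = left_normed_comm (left_normed_comm us # vs)"
  by (simp add: left_normed_comm_def)

text \<open>Writing the length as \<open>Suc m\<close> excludes the empty list, whose
  \<open>hd\<close> is unspecified.\<close>

lemma comm_gens_subset:
  "{left_normed_comm us | us. length us = Suc m \<and> set us \<subseteq> FA n} \<subseteq> FA n"
  by (auto intro!: FA_left_normed_comm)

lemma ideal_comm_ideal: "ideal (comm_ideal n (Suc m)) (free_algebra n)"
  unfolding comm_ideal_def by (rule ring.genideal_ideal[OF ring_free_algebra comm_gens_subset])

lemma left_normed_comm_in_comm_ideal:
  "length us = Suc m \<Longrightarrow> set us \<subseteq> FA n \<Longrightarrow> left_normed_comm us \<in> comm_ideal n (Suc m)"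
  unfolding comm_ideal_def using ring.genideal_self[OF ring_free_algebra comm_gens_subset] by blast

text \<open>Serves as an induction principle: to prove a property of all elements of the ideal, let
  \<open>J\<close> be the set of elements that have it.\<close>

lemma comm_ideal_minimal:
  assumes "ideal J (free_algebra n)"
    and "\<And>us. length us = Suc m \<Longrightarrow> set us \<subseteq> FA n \<Longrightarrow> left_normed_comm us \<in> J"
  shows "comm_ideal n (Suc m) \<subseteq> J"
  unfolding comm_ideal_def
  by (rule ring.genideal_minimal[OF ring_free_algebra]) (use assms in auto)

lemma comm_ideal_FA: "f \<in> comm_ideal n (Suc m) \<Longrightarrow> f \<in> FA n"
  using ideal.Icarr[OF ideal_comm_ideal] by blast

lemma comm_ideal_0: "0 \<in> comm_ideal n (Suc m)"
  using additive_subgroup.zero_closed[OF ideal.axioms(1)[OF ideal_comm_ideal], of n m] by simp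

lemma comm_ideal_add:
  "f \<in> comm_ideal n (Suc m) \<Longrightarrow> g \<in> comm_ideal n (Suc m) \<Longrightarrow> f + g \<in> comm_ideal n (Suc m)"
  using additive_subgroup.a_closed[OF ideal.axioms(1)[OF ideal_comm_ideal], of f n m g] by simp

lemma comm_ideal_lmult: "a \<in> FA n \<Longrightarrow> f \<in> comm_ideal n (Suc m) \<Longrightarrow> a * f \<in> comm_ideal n (Suc m)"
  using ideal.I_l_closed[OF ideal_comm_ideal, of f n m a] by simp

lemma comm_ideal_rmult: "a \<in> FA n \<Longrightarrow> f \<in> comm_ideal n (Suc m) \<Longrightarrow> f * a \<in> comm_ideal n (Suc m)"
  using ideal.I_r_closed[OF ideal_comm_ideal, of f n m a] by simp

lemma comm_ideal_scale: "f \<in> comm_ideal n (Suc m) \<Longrightarrow> scalar c * f \<in> comm_ideal n (Suc m)"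
  by (simp add: comm_ideal_lmult)

lemma comm_ideal_scale_iff:
  assumes "c \<noteq> 0" shows "scalar c * f \<in> comm_ideal n (Suc m) \<longleftrightarrow> f \<in> comm_ideal n (Suc m)"
  using comm_ideal_scale[of "scalar c * f" n m "inverse c"] comm_ideal_scale[of f n m c] assms
  by (auto simp flip: mult.assoc scalar_mult)

lemma comm_ideal_uminus: "f \<in> comm_ideal n (Suc m) \<Longrightarrow> - f \<in> comm_ideal n (Suc m)"
  using comm_ideal_scale[of f n m "- 1"] by (simp add: scalar_uminus)

lemma comm_ideal_diff:
  "f \<in> comm_ideal n (Suc m) \<Longrightarrow> g \<in> comm_ideal n (Suc m) \<Longrightarrow> f - g \<in> comm_ideal n (Suc m)"
  using comm_ideal_add[OF _ comm_ideal_uminus, of f n m g] by simp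

lemma comm_ideal_sum:
  "(\<And>i. i \<in> A \<Longrightarrow> g i \<in> comm_ideal n (Suc m)) \<Longrightarrow> sum g A \<in> comm_ideal n (Suc m)"
  by (induction A rule: infinite_finite_induct) (simp_all add: comm_ideal_0 comm_ideal_add)

lemma comm_ideal_lin_ext:
  assumes "f \<in> FA n" "\<And>ws. set ws \<subseteq> {..<n} \<Longrightarrow> F ws \<in> comm_ideal n (Suc m)"
  shows "lin_ext F f \<in> comm_ideal n (Suc m)"
  unfolding lin_ext_def using assms
  by (intro comm_ideal_sum comm_ideal_scale) (auto simp: FA_iff[of f])

text \<open>The commutator of the first \<open>q - p + 1\<close> entries is regarded as a single
  entry; with the remaining \<open>p\<close> entries it forms a commutator of length
  \<open>p + 1\<close>.\<close>

lemma comm_ideal_mono: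
  assumes "p \<le> q"
  shows "comm_ideal n (Suc q) \<subseteq> comm_ideal n (Suc p)"
proof (rule comm_ideal_minimal[OF ideal_comm_ideal])
  fix us :: "'a free_alg list"
  assume us: "length us = Suc q" "set us \<subseteq> FA n"
  let ?vs = "take (Suc (q - p)) us" and ?ws = "drop (Suc (q - p)) us"
  have vs: "?vs \<noteq> []" using us by auto
  have "set ?vs \<subseteq> FA n" "set ?ws \<subseteq> FA n"
    using us set_take_subset set_drop_subset by fast+
  then have "left_normed_comm (left_normed_comm ?vs # ?ws) \<in> comm_ideal n (Suc p)"
    using us assms by (intro left_normed_comm_in_comm_ideal) (auto intro!: FA_left_normed_comm vs)
  then show "left_normed_comm us \<in> comm_ideal n (Suc p)"
    by (simp flip: left_normed_comm_append[OF vs])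
qed

section \<open>Stability of the commutator ideals under derivations\<close>

lemma left_normed_comm_derivation:
  assumes add: "\<And>f g. D (f + g) = D f + D g" and diff: "\<And>f g. D (f - g) = D f - D g"
    and mult: "\<And>f g. D (f * g) = D f * g + f * D g"
    and "us \<noteq> []"
  shows "D (left_normed_comm us) = (\<Sum>i<length us. left_normed_comm (us[i := D (us ! i)]))"
  using \<open>us \<noteq> []\<close>
proof (induction us rule: rev_induct)
  case (snoc u us)
  show ?case
  proof (cases "us = []")
    case False
    have "us[i := v] \<noteq> []" for i v using False by simp
    with False have "(\<Sum>i<length (us @ [u]). left_normed_comm ((us @ [u])[i := D ((us @ [u]) ! i)])) =
        (\<Sum>i<length us. left_normed_comm (us[i := D (us ! i)]) * u - u * left_normed_comm (us[i := D (us ! i)]))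
        + (left_normed_comm us * D u - D u * left_normed_comm us)"
      by (simp add: list_update_append nth_append left_normed_comm_snoc)
    also have "\<dots> = D (left_normed_comm us) * u - u * D (left_normed_comm us)
        + (left_normed_comm us * D u - D u * left_normed_comm us)"
      by (simp add: snoc.IH[OF False] sum_subtractf sum_distrib_left sum_distrib_right)
    also have "\<dots> = D (left_normed_comm (us @ [u]))"
      by (simp add: left_normed_comm_snoc[OF False] mult diff)
    finally show ?thesis ..
  qed (simp add: left_normed_comm_def)
qed simp

text \<open>A derivation turns a commutator into a sum of commutators of the same length. The
  Leibniz rule for a multiple \<open>a * f\<close> produces both \<open>f\<close> and its
  derivative, which is why \<open>?J\<close> demands that both lie in the ideal.\<close>

lemma comm_ideal_deriv_ext:
  assumes "f \<in> comm_ideal n (Suc m)" and \<phi>: "\<And>j. j < n \<Longrightarrow> \<phi> j \<in> FA n"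
  shows "deriv_ext \<phi> f \<in> comm_ideal n (Suc m)"
proof -
  let ?J = "{f \<in> comm_ideal n (Suc m). deriv_ext \<phi> f \<in> comm_ideal n (Suc m)}"
  have "ideal ?J (free_algebra n)"
  proof (rule ideal_free_algebraI)
    show "?J \<subseteq> FA n" using comm_ideal_FA by blast
  qed (simp_all add: comm_ideal_0 klinear_0[OF klinear_deriv_ext] deriv_ext_add
        deriv_ext_mult FA_deriv_ext[OF _ \<phi>] comm_ideal_add comm_ideal_lmult comm_ideal_rmult)
  moreover have "left_normed_comm us \<in> ?J" if us: "length us = Suc m" "set us \<subseteq> FA n" for us
  proof -
    have "set (us[i := deriv_ext \<phi> (us ! i)]) \<subseteq> FA n" if "i < length us" for i
    proof -
      have "us ! i \<in> FA n" using us that by auto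
      then have "deriv_ext \<phi> (us ! i) \<in> FA n" by (rule FA_deriv_ext) (rule \<phi>)
      then show ?thesis using us(2) by (meson insert_subset order_trans set_update_subset_insert)
    qed
    then have "(\<Sum>i<length us. left_normed_comm (us[i := deriv_ext \<phi> (us ! i)])) \<in> comm_ideal n (Suc m)"
      by (intro comm_ideal_sum left_normed_comm_in_comm_ideal) (simp_all add: us)
    moreover have "us \<noteq> []" using us by auto
    ultimately show ?thesis
      using left_normed_comm_derivation[of "deriv_ext \<phi>" us, OF deriv_ext_add deriv_ext_diff deriv_ext_mult]
        left_normed_comm_in_comm_ideal[OF us] by simp
  qed
  ultimately have "comm_ideal n (Suc m) \<subseteq> ?J" by (rule comm_ideal_minimal)
  with assms(1) show ?thesis by blast
qed

text \<open>The left ideal generated by commutators of \<open>k + 1\<close> entries ending in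
  \<open>x\<close>. One-sidedness suits nested products: their outer coefficients multiply from the
  left, and fixing the last entry allows the length to be followed through a bracket with
  \<open>x\<close>.\<close>

inductive_set comm_left_ideal :: "nat \<Rightarrow> 'k::field free_alg \<Rightarrow> nat \<Rightarrow> 'k free_alg set"
  for n x k where
  zero: "0 \<in> comm_left_ideal n x k"
| step: "a \<in> FA n \<Longrightarrow> length us = k \<Longrightarrow> set us \<subseteq> FA n \<Longrightarrow> f \<in> comm_left_ideal n x k \<Longrightarrow>
    a * left_normed_comm (us @ [x]) + f \<in> comm_left_ideal n x k"

lemma comm_left_ideal_single:
  "a \<in> FA n \<Longrightarrow> length us = k \<Longrightarrow> set us \<subseteq> FA n \<Longrightarrow>
    a * left_normed_comm (us @ [x]) \<in> comm_left_ideal n x k"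
  using comm_left_ideal.step[OF _ _ _ comm_left_ideal.zero] by fastforce

lemma comm_left_ideal_add:
  "f \<in> comm_left_ideal n x k \<Longrightarrow> g \<in> comm_left_ideal n x k \<Longrightarrow> f + g \<in> comm_left_ideal n x k"
  by (induction f rule: comm_left_ideal.induct) (auto simp: add.assoc intro: comm_left_ideal.step)

lemma comm_left_ideal_lmult:
  assumes "a \<in> FA n"
  shows "f \<in> comm_left_ideal n x k \<Longrightarrow> a * f \<in> comm_left_ideal n x k"
proof (induction f rule: comm_left_ideal.induct)
  case (step b us f)
  then show ?case
    using comm_left_ideal.step[of "a * b" n us k] by (simp add: distrib_left FA_mult assms mult.assoc)
qed (simp add: comm_left_ideal.zero)

lemma comm_left_ideal_uminus: "f \<in> comm_left_ideal n x k \<Longrightarrow> - f \<in> comm_left_ideal n x k"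
  using comm_left_ideal_lmult[OF FA_scalar[of "- 1"]] by (simp add: scalar_uminus)

text \<open>The Leibniz rule applied to a * [w, x] also brackets the coefficient \<open>a\<close>,
  giving a product of two commutators. Together with the other term it equals [w, a, x] x -
  [w, a x, x], in which every commutator has one entry more than [w, x].\<close>

lemma comm_left_ideal_ad:
  assumes x: "x \<in> FA n"
  shows "f \<in> comm_left_ideal n x (Suc k) \<Longrightarrow> x * f - f * x \<in> comm_left_ideal n x (Suc (Suc k))"
proof (induction f rule: comm_left_ideal.induct)
  case (step a us f)
  let ?M = "comm_left_ideal n x (Suc (Suc k))" and ?w = "left_normed_comm us"
  have ne: "us \<noteq> []" using step by auto
  let ?br = "\<lambda>u v. u * v - v * u"
  have c2: "left_normed_comm (us @ [u, v]) = ?br (?br ?w u) v" for u v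
    using left_normed_comm_snoc[of "us @ [u]" v] left_normed_comm_snoc[OF ne, of u] by simp
  have br2: "b * ?br (?br ?w u) x \<in> ?M" if "b \<in> FA n" "u \<in> FA n" for b u
    using comm_left_ideal_single[of b n "us @ [u]" "Suc (Suc k)" x] step that by (simp add: c2)
  \<comment> \<open>[w, a, x, x] has one entry too many for the target; its innermost bracket [v, u]
    is counted as a single entry.\<close>
  have br3: "?br (?br (?br ?w a) x) x \<in> ?M"
  proof -
    obtain v us' where us: "us = v # us'" using ne by (cases us) auto
    obtain u vs where "us' @ [a] = u # vs" by (cases "us' @ [a]") auto
    with us have e: "us @ [a] = v # u # vs" by simp
    let ?vs = "?br v u # vs"
    have "left_normed_comm ((us @ [a]) @ ([x] @ [x])) = left_normed_comm ((?vs @ [x]) @ [x])"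
      unfolding e by (simp add: left_normed_comm_def)
    moreover have "left_normed_comm ((us @ [a]) @ ([x] @ [x])) = ?br (?br (?br ?w a) x) x"
      using left_normed_comm_snoc[of "us @ [a, x]" x] by (simp add: c2)
    moreover have "length us = Suc k" "set (us @ [a]) \<subseteq> FA n" using step by auto
    then have "length ?vs = Suc k" "set ?vs \<subseteq> FA n"
      unfolding e using arg_cong[OF e, of length] by (auto intro!: FA_diff FA_mult)
    ultimately show ?thesis
      using comm_left_ideal_single[of 1 n "?vs @ [x]" "Suc (Suc k)" x] x by simp
  qed
  \<comment> \<open>Expanding \<open>[w, a x, x]\<close> for \<open>w = [u\<^sub>1, \<dots>, u\<^sub>k]\<close> by the product rule yields
    \<open>[a, x] [w, x] = [w, a x, x] - [w, a, x] x - a [w, x, x]\<close>; the right factor \<open>x\<close> is then moved to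
    the left at the cost of \<open>[w, a, x, x]\<close>.\<close>
  have "x * (a * ?br ?w x + f) - (a * ?br ?w x + f) * x =
      - (?br (?br ?w (a * x)) x) + (x * ?br (?br ?w a) x + ?br (?br (?br ?w a) x) x)
      + (x * f - f * x)"
    by (simp add: algebra_simps)
  moreover have "- (?br (?br ?w (a * x)) x) \<in> ?M"
    using br2[of 1 "a * x"] step x by (intro comm_left_ideal_uminus) (simp add: FA_mult)
  moreover have "x * ?br (?br ?w a) x + ?br (?br (?br ?w a) x) x \<in> ?M"
    using br2[of x a] br3 step x by (intro comm_left_ideal_add)
  ultimately show ?case
    using step.IH by (simp only: left_normed_comm_snoc[OF ne] comm_left_ideal_add)
qed (simp add: comm_left_ideal.zero)

lemma comm_left_ideal_subset: "comm_left_ideal n x k \<subseteq> comm_ideal n (Suc k)" if "x \<in> FA n"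
proof
  fix f assume "f \<in> comm_left_ideal n x k"
  then show "f \<in> comm_ideal n (Suc k)"
    by (induction f rule: comm_left_ideal.induct)
      (use that in \<open>auto intro!: comm_ideal_0 comm_ideal_add comm_ideal_lmult left_normed_comm_in_comm_ideal\<close>)
qed

lemma FA_ad_word: "a < n \<Longrightarrow> set ws \<subseteq> {..<n} \<Longrightarrow> ad_word a ws \<in> FA n"
  by (induction ws) (simp_all add: FA_diff FA_mult FA_gen)

text \<open>The word is read from its right end. Letters other than \<open>a\<close> multiply from
  the left. The first \<open>a\<close> met brackets some y and gives [x, y] = -[y, x]; every further
  one lengthens the commutators by \<open>comm_left_ideal_ad\<close>.\<close>

lemma ad_word_in_comm_left_ideal:
  assumes "a < n" "set ws \<subseteq> {..<n}"
  shows "count_list ws a = Suc k \<Longrightarrow> (ad_word a ws :: 'k::field free_alg) \<in> comm_left_ideal n (gen a) (Suc k)"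
  using assms(2)
proof (induction ws arbitrary: k)
  case (Cons j ws)
  show ?case
  proof (cases "j = a")
    case False
    with Cons show ?thesis by (simp add: comm_left_ideal_lmult FA_gen)
  next
    case j: True
    show ?thesis
    proof (cases k)
      case 0
      have "- 1 * left_normed_comm ([ad_word a ws :: 'k free_alg] @ [gen a]) \<in> comm_left_ideal n (gen a) (Suc 0)"
        using Cons.prems assms(1) by (intro comm_left_ideal_single) (simp_all add: FA_ad_word FA_uminus)
      then show ?thesis using 0 j by (simp add: left_normed_comm_def)
    next
      case (Suc l)
      with j Cons have "(ad_word a ws :: 'k free_alg) \<in> comm_left_ideal n (gen a) (Suc l)" by simp
      then show ?thesis using comm_left_ideal_ad[OF FA_gen[OF assms(1)]] Suc j by simp
    qed
  qed
qed simp

text \<open>With q occurrences of \<open>a\<close> the commutators have q + 1 entries, and q is at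
  least p. The bound \<open>p \<ge> 1\<close> guarantees that there is a bracket at all.\<close>

lemma ad_word_in_comm_ideal:
  assumes "a < n" "set ws \<subseteq> {..<n}" "p \<ge> 1" "p \<le> count_list ws a"
  shows "ad_word a ws \<in> comm_ideal n (Suc p)"
proof -
  obtain k where k: "count_list ws a = Suc k" using assms by (cases "count_list ws a") auto
  have "ad_word a ws \<in> comm_ideal n (Suc (Suc k))"
    using ad_word_in_comm_left_ideal[OF assms(1,2) k] comm_left_ideal_subset[OF FA_gen[OF assms(1)]] by blast
  with comm_ideal_mono[of p "Suc k" n] assms k show ?thesis by auto
qed

section \<open>Homogeneous components\<close>

definition hom_comp :: "nat \<Rightarrow> nat \<Rightarrow> 'k::field free_alg \<Rightarrow> 'k free_alg"
  where "hom_comp a q = lin_ext (\<lambda>ws. if count_list ws a = q then word_mon ws else 0)"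

lemma klinear_hom_comp: "klinear (hom_comp a q)"
  unfolding hom_comp_def by (rule klinear_lin_ext)

lemma FA_hom_comp: "f \<in> FA n \<Longrightarrow> hom_comp a q f \<in> FA n"
  unfolding hom_comp_def by (rule FA_lin_ext) (simp_all add: FA_word)

lemma hom_comp_word: "hom_comp a q (word_mon ws) = (if count_list ws a = q then word_mon ws else 0)"
  by (simp add: hom_comp_def)

lemma hom_comp_idem: "hom_comp a q (hom_comp a q f) = hom_comp a q f"
proof (rule klinear_eqI[where f = f])
  show "klinear (\<lambda>f. hom_comp a q (hom_comp a q f))"
    by (rule klinear_comp[OF klinear_hom_comp klinear_hom_comp])
qed (simp_all add: klinear_hom_comp hom_comp_word klinear_0[OF klinear_hom_comp])

lemma hom_comp_gen_mult:
  assumes "j \<noteq> a" shows "hom_comp a q (gen j * f) = gen j * hom_comp a q f"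
    and "hom_comp a (Suc q) (gen a * f) = gen a * hom_comp a q f"
    and "hom_comp a 0 (gen a * f) = 0"
  by (rule klinear_eqI[where f = f];
      use assms in \<open>simp add: klinear_def klinear_add[OF klinear_hom_comp] klinear_scale[OF klinear_hom_comp]
        distrib_left scalar_left_comm hom_comp_word flip: word_mon_Cons\<close>)+

text \<open>Deleting letters \<open>b\<close> does not change the number of letters
  \<open>a\<close>. Thus iterated derivatives in one generator stay homogeneous in another.\<close>

lemma hom_comp_pderiv_gen:
  assumes "a \<noteq> b" shows "hom_comp a q (pderiv_gen b f) = pderiv_gen b (hom_comp a q f)"
proof (rule klinear_eqI[where f = f])
  fix ws
  show "hom_comp a q (pderiv_gen b (word_mon ws)) = pderiv_gen b (hom_comp a q (word_mon ws :: 'a free_alg))"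
  proof (induction ws arbitrary: q)
    case Nil
    show ?case by (simp add: hom_comp_word pderiv_gen_def deriv_ext_word klinear_0[OF klinear_hom_comp]
        klinear_0[OF klinear_deriv_ext])
  next
    case (Cons j ws)
    have p: "pderiv_gen b (gen j * g) = (if j = b then g else 0) + gen j * pderiv_gen b g" for g :: "'a free_alg"
      by (simp add: pderiv_gen_def deriv_ext_mult deriv_ext_gen)
    show ?case
    proof (cases "j = a")
      case True
      with assms p have "pderiv_gen b (gen a * g) = gen a * pderiv_gen b g" for g :: "'a free_alg"
        by simp
      with True assms show ?thesis
        by (cases q) (simp_all add: word_mon_Cons hom_comp_gen_mult[of b] Cons klinear_0[OF klinear_pderiv_gen])
    next
      case False
      then show ?thesis
        by (simp add: word_mon_Cons p hom_comp_gen_mult klinear_add[OF klinear_hom_comp] Cons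
            klinear_0[OF klinear_hom_comp])
    qed
  qed
qed (simp_all add: klinear_def klinear_add[OF klinear_hom_comp] klinear_scale[OF klinear_hom_comp]
    klinear_add[OF klinear_pderiv_gen] klinear_scale[OF klinear_pderiv_gen])

text \<open>In the expansion of \<open>A f\<close> the term at 0 is \<open>f\<close>, and every
  other term contains a derivative of \<open>f\<close> and so lies in the ideal. \<open>A f\<close>
  lies there too, since every word of \<open>f\<close> contains \<open>a\<close> exactly
  \<open>q\<close> times and \<open>q\<close> is at least \<open>p\<close>.\<close>

lemma hom_comp_in_comm_ideal:
  fixes f :: "'k::field_char_0 free_alg"
  assumes f: "f \<in> FA n" "hom_comp a q f = f" and "a < n" "1 \<le> p" "p \<le> q"
    and deriv: "pderiv_gen a f \<in> comm_ideal n (Suc p)"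
  shows "f \<in> comm_ideal n (Suc p)"
proof -
  let ?I = "comm_ideal n (Suc p) :: 'k free_alg set"
  define c :: "nat \<Rightarrow> 'k free_alg" where "c k = scalar ((- 1) ^ k / fact k)" for k
  define A where "A = lin_ext (ad_word a :: nat list \<Rightarrow> 'k free_alg)"
  obtain N where N: "\<And>w. w \<in> Poly_Mapping.keys f \<Longrightarrow> length (letters w) < N"
    using ex_length_bound by blast
  have "A f = (\<Sum>k<Suc N. c k * ((pderiv_gen a ^^ k) f * gen a ^ k))"
  proof (rule klinear_eq_on_keys[where f = f])
    show "klinear (\<lambda>f. \<Sum>k<Suc N. c k * ((pderiv_gen a ^^ k) f * gen a ^ k))"
      by (intro klinear_sum_fun klinear_lmult klinear_rmult klinear_funpow klinear_pderiv_gen)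
    fix w assume "w \<in> Poly_Mapping.keys f"
    then have "length (letters w) < Suc N" using N by (simp add: less_SucI)
    then show "A (word_mon (letters w)) = (\<Sum>k<Suc N. c k * ((pderiv_gen a ^^ k) (word_mon (letters w)) * gen a ^ k))"
      unfolding A_def c_def lin_ext_word by (rule ad_word_eq)
  qed (simp add: A_def klinear_lin_ext)
  also have "\<dots> = f + (\<Sum>k<N. c (Suc k) * ((pderiv_gen a ^^ Suc k) f * gen a ^ Suc k))"
    unfolding sum.lessThan_Suc_shift by (simp add: c_def)
  finally have eq: "A f - (\<Sum>k<N. c (Suc k) * ((pderiv_gen a ^^ Suc k) f * gen a ^ Suc k)) = f"
    by simp
  have "(pderiv_gen a ^^ Suc k) f \<in> ?I" for k
  proof (induction k)
    case (Suc k)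
    then show ?case
      by (subst funpow.simps) (auto simp: pderiv_gen_def intro!: comm_ideal_deriv_ext)
  qed (simp add: deriv)
  then have "(\<Sum>k<N. c (Suc k) * ((pderiv_gen a ^^ Suc k) f * gen a ^ Suc k)) \<in> ?I"
    unfolding c_def by (intro comm_ideal_sum comm_ideal_scale comm_ideal_rmult FA_power FA_gen assms)
  moreover have "A f \<in> ?I"
  proof -
    have "A (hom_comp a q f) = lin_ext (\<lambda>ws. if count_list ws a = q then ad_word a ws else 0) f"
      by (rule klinear_eqI[where f = f])
        (simp_all add: A_def klinear_def klinear_add[OF klinear_hom_comp] klinear_scale[OF klinear_hom_comp]
          klinear_add[OF klinear_lin_ext] klinear_scale[OF klinear_lin_ext] hom_comp_word
          klinear_0[OF klinear_lin_ext])
    also have "\<dots> \<in> ?I"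
      using assms by (intro comm_ideal_lin_ext f) (auto simp: comm_ideal_0 intro!: ad_word_in_comm_ideal)
    finally show ?thesis using f by simp
  qed
  ultimately show ?thesis
    by (subst eq[symmetric]) (rule comm_ideal_diff)
qed

text \<open>The action of the matrix unit \<open>E_ab\<close> of the Lie algebra gl(n), a raising
  operator when \<open>a < b\<close>.\<close>

definition shift_deriv :: "nat \<Rightarrow> nat \<Rightarrow> 'k::field free_alg \<Rightarrow> 'k free_alg"
  where "shift_deriv a b = deriv_ext (\<lambda>j. if j = b then gen a else 0)"

text \<open>Moving iterated derivatives in \<open>gen a\<close> past the shift derivation leaves an
  extra derivative in \<open>gen b\<close>. At the first iterate that enters the ideal, this extra
  term shows that the preceding iterate \<open>g\<close> has its \<open>gen b\<close>-derivative in
  the ideal, and \<open>hom_comp_in_comm_ideal\<close> then puts \<open>g\<close> itself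
  there.\<close>

lemma highest_weight_in_comm_ideal:
  fixes f :: "'k::field_char_0 free_alg"
  assumes f: "f \<in> FA n" "hom_comp b q f = f" and ab: "a < n" "b < n" "a \<noteq> b" and pq: "1 \<le> p" "p \<le> q"
    and shift: "shift_deriv a b f \<in> comm_ideal n (Suc p)"
  shows "f \<in> comm_ideal n (Suc p)"
proof (rule ccontr)
  let ?I = "comm_ideal n (Suc p) :: 'k free_alg set" and ?D = "pderiv_gen a :: 'k free_alg \<Rightarrow> _"
  assume nI: "f \<notin> ?I"
  have DI: "g \<in> ?I \<Longrightarrow> (?D ^^ k) g \<in> ?I" for g k
    by (induction k) (auto simp: pderiv_gen_def intro!: comm_ideal_deriv_ext)
  obtain N where "(?D ^^ N) f = 0" using pderiv_gen_nilpotent by blast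
  then have "\<exists>N. (?D ^^ N) f \<in> ?I" using comm_ideal_0 by metis
  then obtain M where M: "(?D ^^ M) f \<in> ?I" "\<And>k. k < M \<Longrightarrow> (?D ^^ k) f \<notin> ?I"
    by (auto simp: exists_least_iff[of "\<lambda>N. (?D ^^ N) f \<in> ?I"])
  with nI obtain m where m: "M = Suc m" by (cases M) auto
  define g where "g = (?D ^^ m) f"
  have comm: "?D (shift_deriv a b u) - shift_deriv a b (?D u) = pderiv_gen b u" for u
    unfolding pderiv_gen_def shift_deriv_def
    by (rule deriv_ext_commute) (simp add: deriv_ext_gen deriv_ext_1 klinear_0[OF klinear_deriv_ext] ab)
  have comm2: "?D (pderiv_gen b u) = pderiv_gen b (?D u)" for u
  proof -
    have "?D (pderiv_gen b u) - pderiv_gen b (?D u) = deriv_ext (\<lambda>_. 0) u"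
      unfolding pderiv_gen_def
      by (rule deriv_ext_commute) (simp add: deriv_ext_1 klinear_0[OF klinear_deriv_ext] ab)
    also have "deriv_word (\<lambda>_. 0) ws = (0 :: 'k free_alg)" for ws by (induction ws) simp_all
    then have "deriv_ext (\<lambda>_. 0) u = 0" by (simp add: deriv_ext_def lin_ext_def)
    finally show ?thesis by simp
  qed
  \<comment> \<open>The commutator of \<open>?D\<close> with the shift derivation is
    \<open>pderiv_gen b\<close>, which commutes with \<open>?D\<close>; hence moving
    \<open>k\<close> copies across yields \<open>k\<close> equal terms.\<close>
  have "(?D ^^ k) (shift_deriv a b u) = shift_deriv a b ((?D ^^ k) u)
      + of_nat k * pderiv_gen b ((?D ^^ (k - 1)) u)" for k u
  proof (induction k)
    case (Suc k)
    have s: "?D (of_nat k * v) = of_nat k * ?D v" for v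
      by (metis klinear_pderiv_gen klinear_scale scalar_of_nat)
    have "(?D ^^ Suc k) (shift_deriv a b u) = shift_deriv a b ((?D ^^ Suc k) u)
        + pderiv_gen b ((?D ^^ k) u) + of_nat k * pderiv_gen b (?D ((?D ^^ (k - 1)) u))"
      using comm[of "(?D ^^ k) u"]
      by (simp add: Suc klinear_add[OF klinear_pderiv_gen] s comm2 algebra_simps)
    also have "of_nat k * pderiv_gen b (?D ((?D ^^ (k - 1)) u)) = of_nat k * pderiv_gen b ((?D ^^ k) u)"
      by (cases k) simp_all
    finally show ?case by (simp add: algebra_simps)
  qed simp
  from this[of M f] have "scalar (of_nat M) * pderiv_gen b g =
      (?D ^^ M) (shift_deriv a b f) - shift_deriv a b ((?D ^^ M) f)"
    by (simp add: scalar_of_nat g_def m del: of_nat_Suc)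
  also have "\<dots> \<in> ?I"
    using M(1) by (intro comm_ideal_diff DI shift)
      (auto simp: shift_deriv_def FA_gen ab intro!: comm_ideal_deriv_ext)
  \<comment> \<open>\<open>M\<close> is a successor, so it is invertible in characteristic
    0.\<close>
  finally have "pderiv_gen b g \<in> ?I" using m by (subst (asm) comm_ideal_scale_iff) (simp_all del: of_nat_Suc)
  moreover have "g \<in> FA n \<and> hom_comp b q g = g"
    unfolding g_def
  proof (induction m)
    case (Suc m)
    then show ?case using ab
      by (auto simp: hom_comp_pderiv_gen) (auto simp: pderiv_gen_def intro!: FA_deriv_ext)
  qed (simp add: f)
  ultimately have "g \<in> ?I" using hom_comp_in_comm_ideal[of g n b q p] ab pq by blast
  with M(2)[of m] show False by (simp add: m g_def)
qed

section \<open>The action of \<open>GL(n)\<close>\<close>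

lemma free_act_eq_lin_ext:
  "free_act n g = lin_ext (\<lambda>ws. prod_list (map (\<lambda>j. \<Sum>i<n. scalar (g $$ (i, j)) * gen i) ws))"
  by (rule ext) (simp add: free_act_def lin_ext_def)

lemma klinear_free_act: "klinear (free_act n g)"
  unfolding free_act_eq_lin_ext by (rule klinear_lin_ext)

lemmas free_act_add = klinear_add[OF klinear_free_act]
  and free_act_diff = klinear_diff[OF klinear_free_act]
  and free_act_scale = klinear_scale[OF klinear_free_act]

lemma free_act_word:
  "free_act n g (word_mon ws) = prod_list (map (\<lambda>j. \<Sum>i<n. scalar (g $$ (i, j)) * gen i) ws)"
  by (simp add: free_act_eq_lin_ext)

lemma free_act_gen: "free_act n g (gen j) = (\<Sum>i<n. scalar (g $$ (i, j)) * gen i)"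
  by (simp add: gen_eq_word_mon free_act_word)

lemma free_act_1: "free_act n g 1 = 1"
  using free_act_word[of n g "[]"] by (simp add: word_mon_Nil)

lemma free_act_mult: "free_act n g (u * v) = free_act n g u * free_act n g v"
proof -
  have *: "free_act n g (word_mon ws * v) = free_act n g (word_mon ws) * free_act n g v" for ws
    by (rule klinear_eqI[where f = v])
      (simp_all add: klinear_def free_act_add free_act_scale distrib_left scalar_left_comm free_act_word
        flip: word_mon_append)
  show ?thesis
    by (rule klinear_eqI[where f = u])
      (simp_all add: * klinear_def free_act_add free_act_scale distrib_right mult.assoc)
qed

lemma FA_free_act: "f \<in> FA n \<Longrightarrow> free_act n g f \<in> FA n"
  unfolding free_act_eq_lin_ext
proof (rule FA_lin_ext)
  fix ws
  show "prod_list (map (\<lambda>j. \<Sum>i<n. scalar (g $$ (i, j)) * gen i) ws) \<in> FA n"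
    by (induction ws) (auto intro!: FA_mult FA_sum FA_gen)
qed

text \<open>The action is by algebra endomorphisms that preserve the carrier, so it takes generating
  commutators to generating commutators.\<close>

lemma comm_ideal_free_act:
  assumes "f \<in> comm_ideal n (Suc m)" shows "free_act n g f \<in> comm_ideal n (Suc m)"
proof -
  let ?J = "{f \<in> comm_ideal n (Suc m). free_act n g f \<in> comm_ideal n (Suc m)}"
  have "ideal ?J (free_algebra n)"
  proof (rule ideal_free_algebraI)
    show "?J \<subseteq> FA n" using comm_ideal_FA by blast
  qed (simp_all add: comm_ideal_0 klinear_0[OF klinear_free_act] free_act_add
        free_act_mult FA_free_act comm_ideal_add comm_ideal_lmult comm_ideal_rmult)
  moreover have "left_normed_comm us \<in> ?J" if us: "length us = Suc m" "set us \<subseteq> FA n" for us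
  proof -
    have "free_act n g (foldl (\<lambda>u v. u * v - v * u) u vs) =
        foldl (\<lambda>u v. u * v - v * u) (free_act n g u) (map (free_act n g) vs)" for u vs
      by (induction vs arbitrary: u) (simp_all add: free_act_diff free_act_mult)
    then have "free_act n g (left_normed_comm us) = left_normed_comm (map (free_act n g) us)"
      using us by (cases us) (simp_all add: left_normed_comm_def)
    moreover have "set (map (free_act n g) us) \<subseteq> FA n" using us by (auto intro: FA_free_act)
    ultimately show ?thesis
      using us left_normed_comm_in_comm_ideal[of us m n]
        left_normed_comm_in_comm_ideal[of "map (free_act n g) us" m n] by simp
  qed
  ultimately have "comm_ideal n (Suc m) \<subseteq> ?J" by (rule comm_ideal_minimal)
  with assms show ?thesis by blast
qed

text \<open>Both sides are multiplicative, so the generators suffice, and there the claim is the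
  formula for the matrix product. It is confined to \<open>FA n\<close> because matrix entries
  outside the n columns carry no information.\<close>

lemma free_act_free_act:
  assumes g: "g \<in> carrier_mat n n" and h: "h \<in> carrier_mat n n" and f: "f \<in> FA n"
  shows "free_act n g (free_act n h f) = free_act n (g * h) f"
proof (rule klinear_eq_on_FA[OF _ klinear_free_act f, where S = "\<lambda>f. free_act n g (free_act n h f)"])
  fix ws :: "nat list" assume "set ws \<subseteq> {..<n}"
  then show "free_act n g (free_act n h (word_mon ws)) = free_act n (g * h) (word_mon ws)"
  proof (induction ws)
    case (Cons j ws)
    have "free_act n g (free_act n h (gen j)) =
        (\<Sum>i<n. \<Sum>k<n. scalar (h $$ (i, j)) * (scalar (g $$ (k, i)) * gen k))"
      by (simp add: free_act_gen klinear_sum[OF klinear_free_act] free_act_scale sum_distrib_left)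
    also have "\<dots> = (\<Sum>k<n. scalar (\<Sum>i<n. g $$ (k, i) * h $$ (i, j)) * gen k)"
    proof (subst sum.swap, rule sum.cong[OF refl])
      fix k
      have "scalar (\<Sum>i<n. g $$ (k, i) * h $$ (i, j)) = (\<Sum>i<n. scalar (g $$ (k, i) * h $$ (i, j)))"
        by (rule sum_comp_morphism[symmetric, unfolded o_def]) (simp_all add: scalar_add)
      then show "(\<Sum>i<n. scalar (h $$ (i, j)) * (scalar (g $$ (k, i)) * gen k)) =
          scalar (\<Sum>i<n. g $$ (k, i) * h $$ (i, j)) * gen k"
        by (simp add: sum_distrib_right mult.commute[of "g $$ _"] scalar_mult mult.assoc)
    qed
    also have "\<dots> = free_act n (g * h) (gen j)"
      unfolding free_act_gen using g h Cons.prems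
      by (intro sum.cong refl) (simp add: scalar_prod_def atLeast0LessThan)
    finally show ?case using Cons by (simp add: word_mon_Cons free_act_mult)
  qed (simp add: word_mon_Nil free_act_1)
qed (rule klinear_comp[OF klinear_free_act klinear_free_act])

lemma free_act_one:
  fixes f :: "'k::field free_alg"
  assumes "f \<in> FA n" shows "free_act n (1\<^sub>m n) f = f"
proof (rule klinear_eq_on_FA[OF klinear_free_act klinear_id assms])
  fix ws :: "nat list" assume "set ws \<subseteq> {..<n}"
  then show "free_act n (1\<^sub>m n) (word_mon ws) = (word_mon ws :: 'k free_alg)"
  proof (induction ws)
    case (Cons j ws)
    have "free_act n (1\<^sub>m n) (gen j :: 'k free_alg) = (\<Sum>i<n. if i = j then gen i else 0)"
      unfolding free_act_gen using Cons.prems by (intro sum.cong) auto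
    with Cons show ?case by (simp add: word_mon_Cons free_act_mult)
  qed (simp add: word_mon_Nil free_act_1)
qed

text \<open>\<open>invertible_mat\<close> does not state the dimensions of the inverse; they are
  read off from the two product identities.\<close>

lemma GL_inverse:
  assumes "g \<in> GL n"
  obtains h where "h \<in> carrier_mat n n" "g * h = 1\<^sub>m n"
proof -
  from assms obtain h where g: "g \<in> carrier_mat n n" and h: "inverts_mat g h" "inverts_mat h g"
    unfolding GL_def invertible_mat_def by blast
  have gh: "g * h = 1\<^sub>m n" using g h(1) by (simp add: inverts_mat_def)
  have hg: "h * g = 1\<^sub>m (dim_row h)" using h(2) by (simp add: inverts_mat_def)
  have "dim_col h = n" using arg_cong[OF gh, of dim_col] by simp
  moreover have "dim_row h = n" using arg_cong[OF hg, of dim_col] g by simp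
  ultimately show thesis using that gh by blast
qed

lemma GL_upper_triangular:
  fixes b :: "'k::field mat"
  assumes b: "b \<in> carrier_mat n n" "upper_triangular b" and "\<And>i. i < n \<Longrightarrow> b $$ (i, i) \<noteq> 0"
  shows "b \<in> GL n"
proof -
  have "det b \<noteq> 0"
    using upper_triangular_imp_det_eq_0_iff[OF b] assms by (auto simp: diag_mat_def)
  from det_non_zero_imp_unit[OF b(1) this] obtain h
    where "h \<in> carrier_mat n n" "b * h = 1\<^sub>m n" "h * b = 1\<^sub>m n"
    by (auto simp: Units_def ring_mat_def)
  with b show ?thesis
    by (auto simp: GL_def invertible_mat_def inverts_mat_def square_mat.simps)
qed

section \<open>Cosets of the commutator ideals\<close>

lemma coset_eq: "a_r_coset (free_algebra n) J f = (\<lambda>h. h + f) ` J"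
  by (auto simp: a_r_coset_def')

text \<open>The image is a whole coset because \<open>g\<close> maps the ideal onto itself: the
  inverse matrix supplies preimages inside the ideal.\<close>

lemma free_act_coset:
  assumes g: "g \<in> GL n" and f: "f \<in> FA n"
  shows "free_act n g ` (comm_ideal n (Suc m) +>\<^bsub>free_algebra n\<^esub> f) =
    comm_ideal n (Suc m) +>\<^bsub>free_algebra n\<^esub> free_act n g f"
proof -
  from g have gc: "g \<in> carrier_mat n n" by (simp add: GL_def)
  obtain h where h: "h \<in> carrier_mat n n" "g * h = 1\<^sub>m n" using GL_inverse[OF g] .
  have "u \<in> free_act n g ` comm_ideal n (Suc m)" if "u \<in> comm_ideal n (Suc m)" for u
  proof
    show "u = free_act n g (free_act n h u)"
      using that by (simp add: free_act_free_act[OF gc h(1) comm_ideal_FA] h(2) free_act_one comm_ideal_FA)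
  qed (rule comm_ideal_free_act[OF that])
  then have im: "free_act n g ` comm_ideal n (Suc m) = comm_ideal n (Suc m)"
    by (auto intro: comm_ideal_free_act)
  have "free_act n g ` (\<lambda>h. h + f) ` comm_ideal n (Suc m) =
      (\<lambda>h. h + free_act n g f) ` free_act n g ` comm_ideal n (Suc m)"
    by (simp add: image_image free_act_add)
  then show ?thesis unfolding coset_eq im .
qed

lemma coset_eq_iff:
  assumes "f \<in> FA n" "g \<in> FA n"
  shows "comm_ideal n (Suc m) +>\<^bsub>free_algebra n\<^esub> f = comm_ideal n (Suc m) +>\<^bsub>free_algebra n\<^esub> g \<longleftrightarrow>
    f - g \<in> comm_ideal n (Suc m)"
  using ring.quotient_eq_iff_same_a_r_cos[OF ring_free_algebra ideal_comm_ideal assms, of m]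
  by (simp add: a_minus_def a_inv_free_algebra assms)

section \<open>One-parameter subgroups\<close>

text \<open>A polynomial in t with values in the ideal has its coefficients there. Instead of
  inverting a Vandermonde matrix, the induction eliminates the top coefficient by comparing t with 2
  t; the powers of 2 are distinct in characteristic 0. The top coefficient is then recovered at t =
  1. Only nonzero t are tested, since torus elements must be invertible.\<close>

lemma comm_ideal_vandermonde:
  fixes v :: "nat \<Rightarrow> 'k::field_char_0 free_alg"
  assumes "\<And>t. t \<noteq> 0 \<Longrightarrow> (\<Sum>k<N. scalar (t ^ k) * v k) \<in> comm_ideal n (Suc m)" and "k < N"
  shows "v k \<in> comm_ideal n (Suc m)"
  using assms
proof (induction N arbitrary: v k)
  case (Suc N)
  let ?I = "comm_ideal n (Suc m) :: 'k free_alg set"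
  \<comment> \<open>With \<open>s(t)\<close> the given sum, \<open>s(2 t) - 2\<^sup>N s(t)\<close> has no term of degree \<open>N\<close>.\<close>
  have lower: "v k \<in> ?I" if "k < N" for k
  proof -
    have "(\<Sum>k<N. scalar (t ^ k) * (scalar (2 ^ k - 2 ^ N) * v k)) \<in> ?I" if "t \<noteq> 0" for t
    proof -
      have "(\<Sum>k<Suc N. scalar ((2 * t) ^ k) * v k) - scalar (2 ^ N) * (\<Sum>k<Suc N. scalar (t ^ k) * v k) =
          (\<Sum>k<N. scalar ((2 * t) ^ k) * v k - scalar (2 ^ N) * (scalar (t ^ k) * v k))"
        by (simp add: sum_subtractf sum_distrib_left distrib_left power_mult_distrib scalar_mult mult.assoc)
      also have "\<dots> = (\<Sum>k<N. scalar (t ^ k) * (scalar (2 ^ k - 2 ^ N) * v k))"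
        by (simp add: power_mult_distrib algebra_simps flip: mult.assoc scalar_mult scalar_diff left_diff_distrib)
      finally have eq: "(\<Sum>k<Suc N. scalar ((2 * t) ^ k) * v k) - scalar (2 ^ N) * (\<Sum>k<Suc N. scalar (t ^ k) * v k) =
          (\<Sum>k<N. scalar (t ^ k) * (scalar (2 ^ k - 2 ^ N) * v k))" .
      show ?thesis
        unfolding eq[symmetric] using that by (intro comm_ideal_diff comm_ideal_scale Suc.prems(1)) simp_all
    qed
    from Suc.IH[OF this that] have "scalar (2 ^ k - 2 ^ N) * v k \<in> ?I" by simp
    moreover have "of_nat (2 ^ k) \<noteq> (of_nat (2 ^ N) :: 'k)"
      unfolding of_nat_eq_iff using that by simp
    then have "(2 :: 'k) ^ k - 2 ^ N \<noteq> 0" by simp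
    ultimately show ?thesis by (simp add: comm_ideal_scale_iff)
  qed
  have "(\<Sum>k<Suc N. scalar (1 ^ k) * v k) - (\<Sum>k<N. v k) \<in> ?I"
    by (intro comm_ideal_diff comm_ideal_sum lower Suc.prems(1)) simp_all
  then have "v N \<in> ?I" by simp
  with lower Suc.prems(2) show ?case by (cases "k = N") auto
qed simp

text \<open>The torus element multiplies the component of degree k in \<open>gen a\<close> by t^k.
  Comparing coefficients of t^q with those of t^q f gives the claim.\<close>

lemma torus_hom_comp:
  fixes f :: "'k::field_char_0 free_alg"
  assumes f: "f \<in> FA n" "a < n"
    and torus: "\<And>t. t \<noteq> 0 \<Longrightarrow>
      free_act n (mat n n (\<lambda>(i, j). if i = j then if i = a then t else 1 else 0)) f - scalar (t ^ q) * f
        \<in> comm_ideal n (Suc m)"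
  shows "hom_comp a q f - f \<in> comm_ideal n (Suc m)"
proof -
  obtain N0 where N0: "\<And>w. w \<in> Poly_Mapping.keys f \<Longrightarrow> length (letters w) < N0"
    using ex_length_bound by blast
  \<comment> \<open>\<open>N\<close> exceeds both all degrees occurring in \<open>f\<close> and
    \<open>q\<close>, so that the subtracted term t^q f falls within the range of the sum.\<close>
  define N where "N = max N0 (Suc q)"
  have "q < N" by (simp add: N_def)
  have act: "free_act n (mat n n (\<lambda>(i, j). if i = j then if i = a then t else 1 else 0)) f =
      (\<Sum>k<N. scalar (t ^ k) * hom_comp a k f)" (is "?T f = _") for t
  proof (rule klinear_eq_on_keys[OF klinear_free_act])
    show "klinear (\<lambda>f. \<Sum>k<N. scalar (t ^ k) * hom_comp a k f)"
      by (rule klinear_sum_fun[OF klinear_lmult[OF klinear_hom_comp]])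
    fix w assume w: "w \<in> Poly_Mapping.keys f"
    have "set ws \<subseteq> {..<n} \<Longrightarrow> ?T (word_mon ws) = scalar (t ^ count_list ws a) * word_mon ws" for ws
    proof (induction ws)
      case (Cons j ws)
      have "?T (gen j) = (\<Sum>i<n. if i = j then scalar (if j = a then t else 1) * gen i else 0)"
        unfolding free_act_gen using Cons.prems by (intro sum.cong) auto
      with Cons have "?T (word_mon (j # ws)) =
          scalar (if j = a then t else 1) * gen j * (scalar (t ^ count_list ws a) * word_mon ws)"
        by (simp add: word_mon_Cons free_act_mult)
      then show ?case
        by (simp add: word_mon_Cons scalar_mult scalar_left_comm[of "gen j"] mult.assoc)
    qed (simp add: free_act_1 word_mon_Nil)
    moreover have "set (letters w) \<subseteq> {..<n}" using f w by (simp add: FA_iff)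
    moreover have "count_list (letters w) a < N"
      using N0[OF w] count_le_length[of "letters w" a] by (simp add: N_def)
    ultimately show "?T (word_mon (letters w)) = (\<Sum>k<N. scalar (t ^ k) * hom_comp a k (word_mon (letters w)))"
      by (simp add: hom_comp_word if_distrib[of "\<lambda>u. _ * u"] cong: if_cong)
  qed
  have "(\<Sum>k<N. scalar (t ^ k) * (hom_comp a k f - (if k = q then f else 0))) \<in> comm_ideal n (Suc m)"
    if "t \<noteq> 0" for t
  proof -
    have "(\<Sum>k<N. scalar (t ^ k) * (hom_comp a k f - (if k = q then f else 0))) =
        (\<Sum>k<N. scalar (t ^ k) * hom_comp a k f) - scalar (t ^ q) * f"
      using \<open>q < N\<close>
      by (simp add: right_diff_distrib sum_subtractf if_distrib[of "\<lambda>u. _ * u"] cong: if_cong)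
    with torus[OF that] act show ?thesis by simp
  qed
  from comm_ideal_vandermonde[OF this, of q] show ?thesis by (simp add: N_def)
qed

text \<open>The coefficient of \<open>t\<^sup>k\<close> after substituting \<open>x\<^sub>b + t x\<^sub>a\<close> for \<open>x\<^sub>b\<close> in a word.\<close>

primrec shift_word :: "nat \<Rightarrow> nat \<Rightarrow> nat \<Rightarrow> nat list \<Rightarrow> 'k::field free_alg"
  where "shift_word a b k [] = (if k = 0 then 1 else 0)"
  | "shift_word a b k (j # ws) = gen j * shift_word a b k ws +
      (if j = b \<and> k > 0 then gen a * shift_word a b (k - 1) ws else 0)"

lemma shift_word_0: "shift_word a b 0 ws = word_mon ws"
  by (induction ws) (simp_all add: word_mon_Nil word_mon_Cons)

text \<open>Differentiating the substitution at t = 0 gives the derivation that sends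
  \<open>gen b\<close> to \<open>gen a\<close>.\<close>

lemma shift_word_1: "shift_word a b 1 ws = deriv_word (\<lambda>j. if j = b then gen a else 0) ws"
  by (induction ws) (simp_all add: shift_word_0)

text \<open>The matrix is 1 + t \<open>E_ab\<close>. Its action is polynomial in t with constant
  term \<open>f\<close>; once \<open>f\<close> is subtracted, the linear coefficient must lie in the
  ideal.\<close>

lemma unipotent_shift_deriv:
  fixes f :: "'k::field_char_0 free_alg"
  assumes f: "f \<in> FA n" "a < n" "b < n" "a \<noteq> b"
    and unip: "\<And>t. free_act n (mat n n (\<lambda>(i, j). if i = j then 1 else if i = a \<and> j = b then t else 0)) f - f
        \<in> comm_ideal n (Suc m)"
  shows "shift_deriv a b f \<in> comm_ideal n (Suc m)"
proof -
  obtain N0 where N0: "\<And>w. w \<in> Poly_Mapping.keys f \<Longrightarrow> length (letters w) < N0"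
    using ex_length_bound by blast
  \<comment> \<open>The two extra steps ensure \<open>1 < N\<close> even when
    \<open>N0 = 0\<close>.\<close>
  define N where "N = Suc (Suc N0)"
  have act: "free_act n (mat n n (\<lambda>(i, j). if i = j then 1 else if i = a \<and> j = b then t else 0)) f =
      (\<Sum>k<N. scalar (t ^ k) * lin_ext (shift_word a b k) f)" (is "?T f = _") for t
  proof (rule klinear_eq_on_keys[OF klinear_free_act])
    show "klinear (\<lambda>f. \<Sum>k<N. scalar (t ^ k) * lin_ext (shift_word a b k) f)"
      by (rule klinear_sum_fun[OF klinear_lmult[OF klinear_lin_ext]])
    fix w assume w: "w \<in> Poly_Mapping.keys f"
    have "set ws \<subseteq> {..<n} \<Longrightarrow> length ws < M \<Longrightarrow>
        ?T (word_mon ws) = (\<Sum>k<M. scalar (t ^ k) * shift_word a b k ws)" for ws M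
    proof (induction ws arbitrary: M)
      case Nil
      then show ?case
        by (simp add: word_mon_Nil free_act_1 if_distrib[of "\<lambda>u. _ * u"] cong: if_cong)
    next
      case (Cons j ws)
      obtain L where L: "M = Suc L" "length ws < L" using Cons.prems by (cases M) auto
      let ?s = "\<lambda>k. shift_word a b k ws :: 'k free_alg"
      \<comment> \<open>As \<open>a\<close> and \<open>b\<close> differ, the diagonal entry and the
        entry t never coincide, so column \<open>j\<close> splits into two sums with one possible
        nonzero term each.\<close>
      have "?T (gen j) = (\<Sum>i<n. (if i = j then gen i else 0) + (if i = a then if j = b then scalar t * gen i else 0 else 0))"
        unfolding free_act_gen using Cons.prems f by (intro sum.cong) auto
      also have "\<dots> = gen j + (if j = b then scalar t * gen a else 0)"
        using Cons.prems f by (simp add: sum.distrib)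
      finally have "?T (word_mon (j # ws)) = gen j * (\<Sum>k<M. scalar (t ^ k) * ?s k)
          + (if j = b then scalar t * gen a * (\<Sum>k<L. scalar (t ^ k) * ?s k) else 0)"
        using Cons.IH[of M] Cons.IH[of L] Cons.prems L
        by (simp add: word_mon_Cons free_act_mult distrib_right del: sum.lessThan_Suc)
      \<comment> \<open>The factor t raises the exponent by one, so the sum up to \<open>L\<close>
        becomes the part of the sum up to \<open>M = Suc L\<close> with positive index.\<close>
      also have "(if j = b then scalar t * gen a * (\<Sum>k<L. scalar (t ^ k) * ?s k) else 0) =
          (\<Sum>k<M. if j = b \<and> k > 0 then scalar (t ^ k) * (gen a * ?s (k - 1)) else 0)"
        unfolding L sum.lessThan_Suc_shift
        by (simp add: sum_distrib_left scalar_mult scalar_left_comm[of "gen a"] mult.assoc)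
      finally show ?case
        by (simp add: sum_distrib_left scalar_left_comm[of "gen j"] distrib_left sum.distrib
            if_distrib[of "\<lambda>u. _ * u"] cong: if_cong)
    qed
    moreover have "set (letters w) \<subseteq> {..<n}" using f w by (simp add: FA_iff)
    moreover have "length (letters w) < N" using N0[OF w] by (simp add: N_def)
    ultimately show "?T (word_mon (letters w)) =
        (\<Sum>k<N. scalar (t ^ k) * lin_ext (shift_word a b k) (word_mon (letters w)))"
      by simp
  qed
  have "(\<Sum>k<N. scalar (t ^ k) * (lin_ext (shift_word a b k) f - (if k = 0 then f else 0)))
      \<in> comm_ideal n (Suc m)" for t
  proof -
    have "(\<Sum>k<N. scalar (t ^ k) * (lin_ext (shift_word a b k) f - (if k = 0 then f else 0))) =
        (\<Sum>k<N. scalar (t ^ k) * lin_ext (shift_word a b k) f) - f"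
      by (simp add: right_diff_distrib sum_subtractf N_def if_distrib[of "\<lambda>u. _ * u"]
          del: sum.lessThan_Suc cong: if_cong)
    with unip[of t] act show ?thesis by simp
  qed
  from comm_ideal_vandermonde[OF this, of 1] show ?thesis
    by (simp add: N_def shift_deriv_def deriv_ext_def shift_word_1[abs_def, unfolded One_nat_def])
qed

section \<open>Highest weight vectors\<close>

lemma rel_free_nilp_sel:
  "carrier (rel_free_nilp n p) = (\<lambda>f. comm_ideal n (Suc p) +>\<^bsub>free_algebra n\<^esub> f) ` FA n"
  "act (rel_free_nilp n p) g A = free_act n g ` A"
  by (auto simp: rel_free_nilp_def Let_def FactRing_def A_RCOSETS_defs a_r_coset_def)

lemma smult_rel_free_nilp:
  assumes "f \<in> FA n"
  shows "c \<odot>\<^bsub>rel_free_nilp n p\<^esub> (comm_ideal n (Suc p) +>\<^bsub>free_algebra n\<^esub> f) =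
    comm_ideal n (Suc p) +>\<^bsub>free_algebra n\<^esub> (scalar c * f)"
  using ideal.rcoset_mult_add[OF ideal_comm_ideal[of n p] FA_scalar[of c] assms]
  by (simp add: rel_free_nilp_def Let_def FactRing_def)

lemma gl_module_act_zero:
  assumes "gl_module n M" "g \<in> GL n"
  shows "act M g \<zero>\<^bsub>M\<^esub> = \<zero>\<^bsub>M\<^esub>"
proof -
  interpret vectorspace class_ring M using assms(1) by (rule gl_module.vectorspace)
  have "mod_hom class_ring M M (act M g)"
    by unfold_locales (rule gl_module.act_linear[OF assms])
  then show ?thesis by (rule mod_hom.f0_is_0)
qed

text \<open>A highest weight vector of one summand is pulled back along the isomorphism, and a
  representative of the resulting coset is chosen. The Borel action on it is then known modulo the
  ideal.\<close>

lemma highest_weight_vector_lift: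
  fixes n p :: nat and V :: "nat list \<Rightarrow> ('k::field, 'v) gl_struct" and m :: "nat list \<Rightarrow> nat"
  assumes V: "\<And>mu. mu \<in> partitions n \<Longrightarrow> is_V n mu (V mu)"
    and iso: "gl_isomorphic n (rel_free_nilp n p :: ('k, 'k free_alg set) gl_struct)
      (gl_direct_sum (SIGMA mu:partitions n. {..<m mu}) (\<lambda>(mu, _). V mu))"
    and lam: "lam \<in> partitions n" "m lam \<noteq> 0"
  obtains f :: "'k free_alg" where "f \<in> FA n" "f \<notin> comm_ideal n (Suc p)"
    "\<And>b. b \<in> GL n \<Longrightarrow> upper_triangular b \<Longrightarrow>
      free_act n b f - scalar (\<Prod>i<n. b $$ (i, i) ^ (lam ! i)) * f \<in> comm_ideal n (Suc p)"
proof -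
  let ?I = "comm_ideal n (Suc p) :: 'k free_alg set"
  let ?cos = "\<lambda>f. ?I +>\<^bsub>free_algebra n\<^esub> f"
  define S where "S = (SIGMA mu:partitions n. {..<m mu})"
  define W where "W = (\<lambda>(mu, _ :: nat). V mu)"
  define M where "M = (rel_free_nilp n p :: ('k, 'k free_alg set) gl_struct)"
  define N where "N = gl_direct_sum S W"
  have glW: "gl_module n (W i)" if "i \<in> S" for i
    using V that by (auto simp: S_def W_def is_V_def gl_irreducible_def)
  have modW: "Module.module class_ring (W i)" if "i \<in> S" for i
    using gl_module.vectorspace[OF glW[OF that]] by (rule vectorspace.axioms)
  have i0: "(lam, 0) \<in> S" using lam by (simp add: S_def)
  obtain v where v: "v \<in> carrier (V lam)" "v \<noteq> \<zero>\<^bsub>V lam\<^esub>"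
    and vb: "\<And>b. b \<in> GL n \<Longrightarrow> upper_triangular b \<Longrightarrow>
      act (V lam) b v = (\<Prod>i<n. b $$ (i, i) ^ (lam ! i)) \<odot>\<^bsub>V lam\<^esub> v"
    using V[OF lam(1)] by (auto simp: is_V_def has_highest_weight_def)
  obtain h where h: "h \<in> LinearCombinations.module_hom class_ring M N"
    and bij: "bij_betw h (carrier M) (carrier N)"
    and equi: "\<And>g A. g \<in> GL n \<Longrightarrow> A \<in> carrier M \<Longrightarrow> h (act M g A) = act N g (h A)"
    using iso unfolding gl_isomorphic_def M_def N_def S_def W_def by blast
  \<comment> \<open>The copies of \<open>V lam\<close> are indexed by (lam, j) with
    \<open>j < m lam\<close>, so a nonzero multiplicity provides the index (lam, 0).\<close>
  define e where "e = (\<lambda>i\<in>S. if i = (lam, 0) then v else \<zero>\<^bsub>W i\<^esub>)"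
  have zero_in: "\<zero>\<^bsub>W i\<^esub> \<in> carrier (W i)" if "i \<in> S" for i
    using modW[OF that] by (rule abelian_monoid.zero_closed[OF abelian_group.axioms(1)[OF module.axioms(2)]])
  have "{i \<in> S. e i \<noteq> \<zero>\<^bsub>W i\<^esub>} \<subseteq> {(lam, 0)}" by (auto simp: e_def)
  then have "finite {i \<in> S. e i \<noteq> \<zero>\<^bsub>W i\<^esub>}" by (rule finite_subset) simp
  moreover have "e \<in> (\<Pi>\<^sub>E i\<in>S. carrier (W i))"
    using v zero_in by (auto simp: e_def W_def)
  ultimately have eN: "e \<in> carrier N" by (simp add: N_def gl_direct_sum_def)
  have e_act: "act N b e = (\<Prod>i<n. b $$ (i, i) ^ (lam ! i)) \<odot>\<^bsub>N\<^esub> e"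
    if b: "b \<in> GL n" "upper_triangular b" for b
    unfolding N_def gl_direct_sum_def
  proof (simp, rule restrict_ext)
    fix i assume i: "i \<in> S"
    show "act (W i) b (e i) = (\<Prod>i<n. b $$ (i, i) ^ (lam ! i)) \<odot>\<^bsub>W i\<^esub> e i"
    proof (cases "i = (lam, 0)")
      case True
      then show ?thesis using vb[OF b] i by (simp add: e_def W_def)
    next
      case False
      then show ?thesis
        using gl_module_act_zero[OF glW[OF i] b(1)] module.smult_r_null[OF modW[OF i]] i
        by (simp add: e_def)
    qed
  qed
  from eN have "e \<in> h ` carrier M" unfolding bij_betw_imp_surj_on[OF bij] .
  then obtain A where A: "A \<in> carrier M" "h A = e" by blast
  from A(1) obtain f where f: "f \<in> FA n" "A = ?cos f"
    unfolding M_def rel_free_nilp_sel by (rule imageE)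
  have "f \<notin> ?I"
  proof
    assume "f \<in> ?I"
    \<comment> \<open>Vanishing is expressed as invariance under the scalar 0, which the linear map
      \<open>h\<close> transports to \<open>e\<close> and hence to its coordinate
      \<open>v\<close>.\<close>
    then have "?cos f = ?cos (scalar 0 * f)" by (subst coset_eq_iff) (simp_all add: f)
    then have "A = 0 \<odot>\<^bsub>M\<^esub> A" by (simp add: f smult_rel_free_nilp M_def)
    then have "e = 0 \<odot>\<^bsub>N\<^esub> e" using module_hom_smult[OF h, of 0 A] A by simp
    then have "e (lam, 0) = (0 \<odot>\<^bsub>N\<^esub> e) (lam, 0)" by simp
    also have "\<dots> = 0 \<odot>\<^bsub>V lam\<^esub> e (lam, 0)"
      using i0 by (simp add: N_def gl_direct_sum_def W_def)
    finally have "e (lam, 0) = 0 \<odot>\<^bsub>V lam\<^esub> e (lam, 0)" .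
    then show False
      using module.smult_l_null[OF modW[OF i0], of v] v i0 by (simp add: e_def W_def)
  qed
  moreover have "free_act n b f - scalar (\<Prod>i<n. b $$ (i, i) ^ (lam ! i)) * f \<in> ?I"
    if b: "b \<in> GL n" "upper_triangular b" for b
  proof -
    let ?c = "\<Prod>i<n. b $$ (i, i) ^ (lam ! i)"
    have fb: "free_act n b f \<in> FA n" "scalar ?c * f \<in> FA n"
      using f by (simp_all add: FA_free_act FA_mult)
    have act: "act M b A = ?cos (free_act n b f)"
      by (simp add: M_def rel_free_nilp_sel f free_act_coset[OF b(1)])
    have smult: "?c \<odot>\<^bsub>M\<^esub> A = ?cos (scalar ?c * f)"
      by (simp add: M_def f smult_rel_free_nilp)
    have "h (act M b A) = h (?c \<odot>\<^bsub>M\<^esub> A)"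
      using equi[OF b(1) A(1)] module_hom_smult[OF h, of ?c A] A e_act[OF b] by simp
    then have "?cos (free_act n b f) = ?cos (scalar ?c * f)"
      unfolding act smult using bij fb
      by (intro inj_onD[of h "carrier M"]) (auto simp: bij_betw_def M_def rel_free_nilp_sel)
    then show ?thesis using coset_eq_iff[OF fb] by simp
  qed
  ultimately show thesis by (rule that[OF f(1)])
qed

theorem corollary3p4:
  fixes n p :: nat
    and V :: "nat list \<Rightarrow> ('k::field_char_0, 'v) gl_struct"
    and m :: "nat list \<Rightarrow> nat"
  assumes "n \<ge> 2" and "p \<ge> 1"
    and V: "\<And>lam. lam \<in> partitions n \<Longrightarrow> is_V n lam (V lam)"
    and decomp: "gl_isomorphic n (rel_free_nilp n p :: ('k, 'k free_alg set) gl_struct)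
      (gl_direct_sum (SIGMA lam:partitions n. {..<m lam}) (\<lambda>(lam, _). V lam))"
  shows "\<forall>lam \<in> partitions n. m lam \<noteq> 0 \<longrightarrow> lam ! 1 \<le> p - 1"
proof (intro ballI impI, rule ccontr)
  fix lam assume lam: "lam \<in> partitions n" "m lam \<noteq> 0" and "\<not> lam ! 1 \<le> p - 1"
  then have pq: "p \<le> lam ! 1" by simp
  let ?I = "comm_ideal n (Suc p) :: 'k free_alg set" and ?q = "lam ! 1"
  obtain f where f: "f \<in> FA n" "f \<notin> ?I" and fb: "\<And>b. b \<in> GL n \<Longrightarrow> upper_triangular b \<Longrightarrow>
      free_act n b f - scalar (\<Prod>i<n. b $$ (i, i) ^ (lam ! i)) * f \<in> ?I"
    using highest_weight_vector_lift[OF V decomp lam] by blast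
  \<comment> \<open>Generators are numbered from 0, so index 1 is the second one. The diagonal
    matrix with t in that place has character value t to the power \<open>lam ! 1\<close>.\<close>
  have hom: "hom_comp 1 ?q f - f \<in> ?I"
  proof (rule torus_hom_comp[OF f(1)])
    fix t :: 'k assume t: "t \<noteq> 0"
    let ?b = "mat n n (\<lambda>(i, j). if i = j then if i = 1 then t else 1 else 0)"
    have "(\<Prod>i<n. ?b $$ (i, i) ^ (lam ! i)) = (\<Prod>i<n. if i = 1 then t ^ ?q else 1)"
      by (intro prod.cong) auto
    also have "\<dots> = t ^ ?q" using \<open>n \<ge> 2\<close> by simp
    finally have char: "(\<Prod>i<n. ?b $$ (i, i) ^ (lam ! i)) = t ^ ?q" .
    have ut: "upper_triangular ?b" by auto
    then have "?b \<in> GL n" by (rule GL_upper_triangular[rotated]) (use t in auto)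
    from fb[OF this ut] show "free_act n ?b f - scalar (t ^ ?q) * f \<in> ?I"
      unfolding char .
  qed (use \<open>n \<ge> 2\<close> in simp)
  \<comment> \<open>The matrix 1 + t \<open>E_01\<close> is upper unitriangular, so the character is
    1 and \<open>f\<close> is fixed modulo the ideal.\<close>
  have shift: "shift_deriv 0 1 f \<in> ?I"
  proof (rule unipotent_shift_deriv[OF f(1)])
    fix t :: 'k
    let ?b = "mat n n (\<lambda>(i, j). if i = j then 1 else if i = 0 \<and> j = 1 then t else 0)"
    have char: "(\<Prod>i<n. ?b $$ (i, i) ^ (lam ! i)) = 1"
      by (intro prod.neutral) auto
    have ut: "upper_triangular ?b" by auto
    then have "?b \<in> GL n" by (rule GL_upper_triangular[rotated]) auto
    from fb[OF this ut] show "free_act n ?b f - f \<in> ?I"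
      unfolding char scalar_1 mult_1 .
  qed (use \<open>n \<ge> 2\<close> in simp_all)
  \<comment> \<open>So far \<open>f\<close> is homogeneous only modulo the ideal. It is replaced by
    its exact component, and stability of the ideal under \<open>shift_deriv\<close> carries the
    annihilation condition over.\<close>
  have "shift_deriv 0 1 (hom_comp 1 ?q f - f) \<in> ?I"
    unfolding shift_deriv_def using \<open>n \<ge> 2\<close> by (intro comm_ideal_deriv_ext hom) (simp add: FA_gen)
  from comm_ideal_add[OF this shift] have "shift_deriv 0 1 (hom_comp 1 ?q f) \<in> ?I"
    by (simp add: shift_deriv_def deriv_ext_diff)
  with \<open>n \<ge> 2\<close> \<open>p \<ge> 1\<close> pq have "hom_comp 1 ?q f \<in> ?I"
    using highest_weight_in_comm_ideal[OF FA_hom_comp[OF f(1)] hom_comp_idem, of 0 1 p ?q] by simp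
  from comm_ideal_diff[OF this hom] f(2) show False by simp
qed

end
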